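(* Let $P$ be a Poisson algebra. Then: (1) If $V=(V,\cdot_V,[-,-]_V)$ is a fixed Poisson algebra, then $\approx_l$ is an equivalence relation on the set $\mathcal{LPS}(P,(V,\cdot_V,[-,-]_V))$ of all local crossed systems of $P$ by $(V,\cdot_V,[-,-]_V)$. If $\mathcal{PH}^2(P,(V,\cdot_V,[-,-]_V))$ denotes the quotient set $\mathcal{LPS}(P,(V,\cdot_V,[-,-]_V))/\approx_l$, then the map $$\mathcal{PH}^2(P,(V,\cdot_V,[-,-]_V))\to\mathrm{Ext}(P,(V,\cdot_V,[-,-]_V)),\qquad \overline{(\rightharpoonup,\triangleleft,\vartheta,\triangleright,f)}\longmapsto P\,\sharp_{(\rightharpoonup,\triangleleft,\vartheta,\triangleright,f)}\,V$$ is a bijection. (2) Let $E$ be a vector space and $\pi:E\to P$ an epimorphism of vector spaces with $V=\mathrm{Ker}(\pi)$. Then $$\mathcal{GPH}^2(P,V)=\bigsqcup_{(\cdot_V,[-,-]_V)}\mathcal{PH}^2(P,(V,\cdot_V,[-,-]_V)),$$ where the coproduct on the right hand side is in the category of sets (disjoint union), taken over all possible Poisson algebra structures $(\cdot_V,[-,-]_V)$ on the vector space $V$.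
   Context: $k$ is an arbitrary field; everything is over $k$. Algebras are associative, not necessarily commutative or unital. A Poisson algebra is a vector space $P$ with an associative multiplication $pq$ and a Lie bracket $[-,-]$ such that $[pq,r]=[p,r]q+p[q,r]$ for all $p,q,r\in P$. A morphism of Poisson algebras is a linear map that is a morphism of associative algebras and of Lie algebras. Fix a Poisson algebra $P$ and a Poisson algebra $V=(V,\cdot_V,[-,-]_V)$. A local crossed system of $P$ by $V$ is a 5-tuple $(\rightharpoonup,\triangleleft,\vartheta,\triangleright,f)$ of bilinear maps $\rightharpoonup:P\times V\to V$, $\triangleleft:V\times P\to V$, $\vartheta:P\times P\to V$, $\triangleright:P\times V\to V$, $f:P\times P\to V$ such that for all $p,q,r\in P$, $x,y\in V$: (H1) $(x\cdot_V y)\triangleleft p=x\cdot_V(y\triangleleft p)$; (H2) $(x\triangleleft p)\cdot_V y=x\cdot_V(p\rightharpoonup y)$; (H3) $p\rightharpoonup(x\cdot_V y)=(p\rightharpoonup x)\cdot_V y$; (H4) $(p\rightharpoonup x)\triangleleft q=p\rightharpoonup(x\triangleleft q)$; (H5) $\vartheta(p,q)\triangleleft r=\vartheta(p,qr)-\vartheta(pq,r)+p\rightharpoonup\vartheta(q,r)$; (H6) $(pq)\rightharpoonup x=p\rightharpoonup(q\rightharpoonup x)-\vartheta(p,q)\cdot_V x$; (H7) $x\triangleleft(pq)=(x\triangleleft p)\triangleleft q-x\cdot_V\vartheta(p,q)$; (L1) $f(p,p)=0$; (L2) $p\triangleright[x,y]_V=[p\triangleright x,y]_V+[x,p\triangleright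 y]_V$; (L3) $[p,q]\triangleright x=p\triangleright(q\triangleright x)-q\triangleright(p\triangleright x)+[x,f(p,q)]_V$; (L4) $f(p,[q,r])+f(q,[r,p])+f(r,[p,q])+p\triangleright f(q,r)+q\triangleright f(r,p)+r\triangleright f(p,q)=0$; (P1) $f(pq,r)-f(p,r)\triangleleft q-p\rightharpoonup f(q,r)=r\triangleright\vartheta(p,q)+\vartheta([p,r],q)+\vartheta(p,[q,r])$; (P2) $(pq)\triangleright x=p\rightharpoonup(q\triangleright x)+(p\triangleright x)\triangleleft q-[\vartheta(p,q),x]_V$; (P3) $[p,q]\rightharpoonup x=p\rightharpoonup(q\triangleright x)-q\triangleright(p\rightharpoonup x)-f(p,q)\cdot_V x$; (P4) $p\rightharpoonup[x,y]_V=[p\rightharpoonup x,y]_V-(p\triangleright y)\cdot_V x$; (P5) $x\triangleleft[p,q]=(q\triangleright x)\triangleleft p-q\triangleright(x\triangleleft p)-x\cdot_V f(p,q)$; (P6) $[x,y]_V\triangleleft p=[x\triangleleft p,y]_V-x\cdot_V(p\triangleright y)$; (P7) $p\triangleright(x\cdot_V y)=(p\triangleright x)\cdot_V y+x\cdot_V(p\triangleright y)$. Two local crossed systems satisfy $(\rightharpoonup,\triangleleft,\vartheta,\triangleright,f)\approx_l(\rightharpoonup',\triangleleft',\vartheta',\triangleright',f')$ if there is a linear map $r:P\to V$ such that for all $p,q\in P$, $x\in V$: $p\rightharpoonup x=p\rightharpoonup' x+r(p)\cdot_V x$; $x\triangleleft p=x\triangleleft' p+x\cdot_V r(p)$; $\vartheta(p,q)=\vartheta'(p,q)+p\rightharpoonup'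 r(q)+r(p)\triangleleft' q-r(pq)+r(p)\cdot_V r(q)$; $p\triangleright x=p\triangleright' x+[r(p),x]_V$; $f(p,q)=f'(p,q)+p\triangleright' r(q)-q\triangleright' r(p)+[r(p),r(q)]_V-r([p,q])$. The crossed product $P\,\sharp\,V=P\,\sharp_{(\rightharpoonup,\triangleleft,\vartheta,\triangleright,f)}V$ is the Poisson algebra on $P\times V$ with $(p,x)\star(q,y)=(pq,\ \vartheta(p,q)+p\rightharpoonup y+x\triangleleft q+x\cdot_V y)$ and $\{(p,x),(q,y)\}=([p,q],\ f(p,q)+p\triangleright y-q\triangleright x+[x,y]_V)$; it is an extension $0\to V\to P\,\sharp\,V\to P\to 0$ via $x\mapsto(0,x)$ and $(p,x)\mapsto p$. $\mathrm{Ext}(P,(V,\cdot_V,[-,-]_V))$ is the set of equivalence classes of extensions of $P$ by the fixed Poisson algebra $V$, i.e. of exact sequences of Poisson algebras $0\to V\xrightarrow{i}\mathfrak{E}\xrightarrow{p}P\to0$, where two extensions are equivalent if there is an isomorphism of Poisson algebras $\varphi:\mathfrak{E}\to\mathfrak{E}'$ with $\varphi\circ i=i'$ and $p'\circ\varphi=p$. For a vector space $V$, a crossed system of $P$ by $V$ is a 7-tuple $(\rightharpoonup,\triangleleft,\vartheta,\cdot_V,\triangleright,f,[-,-]_V)$ such that $(V,\cdot_V,[-,-]_V)$ is a Poisson algebra and $(\rightharpoonup,\triangleleft,\vartheta,\triangleright,f)$ is a local crossed system of $P$ by $(V,\cdot_V,[-,-]_V)$. Two crossed systems are cohomologous ($\approx$)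 if $\cdot_V=\cdot_V'$, $[-,-]_V=[-,-]_V'$ and there is a linear map $r:P\to V$ satisfying the five displayed relations above. $\mathcal{GPH}^2(P,V)$ is the quotient by $\approx$ of the set of all crossed systems of $P$ by the vector space $V$. *)

theory Defs
  imports "HOL-Algebra.Module" "HOL-Algebra.AbelCoset"
begin

section \<open>Linear and bilinear maps\<close>

text \<open>
  Vector spaces are modules over a ring record \<open>K\<close> satisfying \<open>field\<close>.  The locale \<open>module\<close>
  puts no constraint on the fields \<open>mult\<close> and \<open>one\<close> of the module record.
\<close>

definition lin_hom ::
  "('k, 'm) ring_scheme \<Rightarrow> ('k, 'a, 'n) module_scheme \<Rightarrow> ('k, 'b, 'l) module_scheme \<Rightarrow> ('a \<Rightarrow> 'b) set"
  where "lin_hom K A B = {h \<in> carrier A \<rightarrow> carrier B.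
     (\<forall>x\<in>carrier A. \<forall>y\<in>carrier A. h (x \<oplus>\<^bsub>A\<^esub> y) = h x \<oplus>\<^bsub>B\<^esub> h y) \<and>
     (\<forall>c\<in>carrier K. \<forall>x\<in>carrier A. h (c \<odot>\<^bsub>A\<^esub> x) = c \<odot>\<^bsub>B\<^esub> h x)}"

definition bilinear ::
  "('k, 'm) ring_scheme \<Rightarrow> ('k, 'a, 'n) module_scheme \<Rightarrow> ('k, 'b, 'l) module_scheme \<Rightarrow>
   ('k, 'c, 'o) module_scheme \<Rightarrow> ('a \<Rightarrow> 'b \<Rightarrow> 'c) \<Rightarrow> bool"
  where "bilinear K A B C h \<longleftrightarrow>
     (\<forall>x\<in>carrier A. h x \<in> lin_hom K B C) \<and>
     (\<forall>y\<in>carrier B. (\<lambda>x. h x y) \<in> lin_hom K A C)"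

text \<open>
  Bilinear maps as elements of a set: they are required to be extensional (\<open>undefined\<close> off the
  carriers), so that HOL equality is equality of maps \<open>A \<times> B \<rightarrow> C\<close>.
\<close>

definition bilinear_maps ::
  "('k, 'm) ring_scheme \<Rightarrow> ('k, 'a, 'n) module_scheme \<Rightarrow> ('k, 'b, 'l) module_scheme \<Rightarrow>
   ('k, 'c, 'o) module_scheme \<Rightarrow> ('a \<Rightarrow> 'b \<Rightarrow> 'c) set"
  where "bilinear_maps K A B C =
     {h \<in> carrier A \<rightarrow>\<^sub>E carrier B \<rightarrow>\<^sub>E carrier C. bilinear K A B C h}"


section \<open>Poisson algebras and their morphisms\<close>

text \<open>
  The associative product is the field \<open>mult\<close>.  The algebra need not be unital; the field
  \<open>one\<close>, inherited from the record of modules, has no meaning.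
\<close>

record ('k, 'a) poisson = "('k, 'a) module" +
  pbracket :: "'a \<Rightarrow> 'a \<Rightarrow> 'a"  ("\<lbrace>_,/ _\<rbrace>\<index>")

locale poisson_algebra = field K + module K P for K and P (structure) +
  assumes mult_bilinear: "bilinear K P P P (mult P)"
    and mult_assoc:
      "\<lbrakk>p \<in> carrier P; q \<in> carrier P; r \<in> carrier P\<rbrakk> \<Longrightarrow>
         (p \<otimes>\<^bsub>P\<^esub> q) \<otimes>\<^bsub>P\<^esub> r = p \<otimes>\<^bsub>P\<^esub> (q \<otimes>\<^bsub>P\<^esub> r)"
    and bracket_bilinear: "bilinear K P P P (pbracket P)"
    and bracket_alternating: "p \<in> carrier P \<Longrightarrow> \<lbrace>p, p\<rbrace>\<^bsub>P\<^esub> = \<zero>\<^bsub>P\<^esub>"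
    and jacobi:
      "\<lbrakk>p \<in> carrier P; q \<in> carrier P; r \<in> carrier P\<rbrakk> \<Longrightarrow>
         \<lbrace>p, \<lbrace>q, r\<rbrace>\<^bsub>P\<^esub>\<rbrace>\<^bsub>P\<^esub> \<oplus>\<^bsub>P\<^esub> \<lbrace>q, \<lbrace>r, p\<rbrace>\<^bsub>P\<^esub>\<rbrace>\<^bsub>P\<^esub> \<oplus>\<^bsub>P\<^esub> \<lbrace>r, \<lbrace>p, q\<rbrace>\<^bsub>P\<^esub>\<rbrace>\<^bsub>P\<^esub> = \<zero>\<^bsub>P\<^esub>"
    and leibniz:
      "\<lbrakk>p \<in> carrier P; q \<in> carrier P; r \<in> carrier P\<rbrakk> \<Longrightarrow>
         \<lbrace>p \<otimes>\<^bsub>P\<^esub> q, r\<rbrace>\<^bsub>P\<^esub> = \<lbrace>p, r\<rbrace>\<^bsub>P\<^esub> \<otimes>\<^bsub>P\<^esub> q \<oplus>\<^bsub>P\<^esub> p \<otimes>\<^bsub>P\<^esub> \<lbrace>q, r\<rbrace>\<^bsub>P\<^esub>"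

definition poisson_hom ::
  "('k, 'm) ring_scheme \<Rightarrow> ('k, 'a) poisson \<Rightarrow> ('k, 'b) poisson \<Rightarrow> ('a \<Rightarrow> 'b) set"
  where "poisson_hom K A B = {h \<in> lin_hom K A B.
     (\<forall>x\<in>carrier A. \<forall>y\<in>carrier A. h (x \<otimes>\<^bsub>A\<^esub> y) = h x \<otimes>\<^bsub>B\<^esub> h y) \<and>
     (\<forall>x\<in>carrier A. \<forall>y\<in>carrier A. h \<lbrace>x, y\<rbrace>\<^bsub>A\<^esub> = \<lbrace>h x, h y\<rbrace>\<^bsub>B\<^esub>)}"

definition with_poisson ::
  "('k, 'a, 'n) module_scheme \<Rightarrow> ('a \<Rightarrow> 'a \<Rightarrow> 'a) \<Rightarrow> ('a \<Rightarrow> 'a \<Rightarrow> 'a) \<Rightarrow> ('k, 'a) poisson"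
  where "with_poisson V m b =
     \<lparr>carrier = carrier V, mult = m, one = one V, zero = zero V, add = add V,
      smult = smult V, pbracket = b\<rparr>"

definition poisson_structures ::
  "('k, 'm) ring_scheme \<Rightarrow> ('k, 'a, 'n) module_scheme \<Rightarrow>
   (('a \<Rightarrow> 'a \<Rightarrow> 'a) \<times> ('a \<Rightarrow> 'a \<Rightarrow> 'a)) set"
  where "poisson_structures K V =
     {(m, b). m \<in> bilinear_maps K V V V \<and> b \<in> bilinear_maps K V V V \<and>
              poisson_algebra K (with_poisson V m b)}"


section \<open>Local crossed systems\<close>

locale local_crossed_system = P: poisson_algebra K P + V: poisson_algebra K V
  for K :: "('k, 'm) ring_scheme" and P :: "('k, 'p) poisson" and V :: "('k, 'v) poisson" +
  fixes lact :: "'p \<Rightarrow> 'v \<Rightarrow> 'v"  (infixr "\<rightharpoonup>" 75)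
    and ract :: "'v \<Rightarrow> 'p \<Rightarrow> 'v"  (infixl "\<triangleleft>" 75)
    and \<theta> :: "'p \<Rightarrow> 'p \<Rightarrow> 'v"
    and lie_act :: "'p \<Rightarrow> 'v \<Rightarrow> 'v"  (infixr "\<triangleright>" 75)
    and f :: "'p \<Rightarrow> 'p \<Rightarrow> 'v"
  assumes lact: "(\<rightharpoonup>) \<in> bilinear_maps K P V V"
    and ract: "(\<triangleleft>) \<in> bilinear_maps K V P V"
    and theta: "\<theta> \<in> bilinear_maps K P P V"
    and lie_act: "(\<triangleright>) \<in> bilinear_maps K P V V"
    and f: "f \<in> bilinear_maps K P P V"
    and H1: "\<lbrakk>p \<in> carrier P; x \<in> carrier V; y \<in> carrier V\<rbrakk> \<Longrightarrow>
      (x \<otimes>\<^bsub>V\<^esub> y) \<triangleleft> p = x \<otimes>\<^bsub>V\<^esub> (y \<triangleleft> p)"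
    and H2: "\<lbrakk>p \<in> carrier P; x \<in> carrier V; y \<in> carrier V\<rbrakk> \<Longrightarrow>
      (x \<triangleleft> p) \<otimes>\<^bsub>V\<^esub> y = x \<otimes>\<^bsub>V\<^esub> (p \<rightharpoonup> y)"
    and H3: "\<lbrakk>p \<in> carrier P; x \<in> carrier V; y \<in> carrier V\<rbrakk> \<Longrightarrow>
      p \<rightharpoonup> (x \<otimes>\<^bsub>V\<^esub> y) = (p \<rightharpoonup> x) \<otimes>\<^bsub>V\<^esub> y"
    and H4: "\<lbrakk>p \<in> carrier P; q \<in> carrier P; x \<in> carrier V\<rbrakk> \<Longrightarrow>
      (p \<rightharpoonup> x) \<triangleleft> q = p \<rightharpoonup> (x \<triangleleft> q)"
    and H5: "\<lbrakk>p \<in> carrier P; q \<in> carrier P; r \<in> carrier P\<rbrakk> \<Longrightarrow>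
      (\<theta> p q) \<triangleleft> r = \<theta> p (q \<otimes>\<^bsub>P\<^esub> r) \<ominus>\<^bsub>V\<^esub> \<theta> (p \<otimes>\<^bsub>P\<^esub> q) r \<oplus>\<^bsub>V\<^esub> (p \<rightharpoonup> \<theta> q r)"
    and H6: "\<lbrakk>p \<in> carrier P; q \<in> carrier P; x \<in> carrier V\<rbrakk> \<Longrightarrow>
      (p \<otimes>\<^bsub>P\<^esub> q) \<rightharpoonup> x = (p \<rightharpoonup> (q \<rightharpoonup> x)) \<ominus>\<^bsub>V\<^esub> (\<theta> p q \<otimes>\<^bsub>V\<^esub> x)"
    and H7: "\<lbrakk>p \<in> carrier P; q \<in> carrier P; x \<in> carrier V\<rbrakk> \<Longrightarrow>
      x \<triangleleft> (p \<otimes>\<^bsub>P\<^esub> q) = ((x \<triangleleft> p) \<triangleleft> q) \<ominus>\<^bsub>V\<^esub> (x \<otimes>\<^bsub>V\<^esub> \<theta> p q)"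
    and L1: "p \<in> carrier P \<Longrightarrow> f p p = \<zero>\<^bsub>V\<^esub>"
    and L2: "\<lbrakk>p \<in> carrier P; x \<in> carrier V; y \<in> carrier V\<rbrakk> \<Longrightarrow>
      p \<triangleright> \<lbrace>x, y\<rbrace>\<^bsub>V\<^esub> = \<lbrace>p \<triangleright> x, y\<rbrace>\<^bsub>V\<^esub> \<oplus>\<^bsub>V\<^esub> \<lbrace>x, p \<triangleright> y\<rbrace>\<^bsub>V\<^esub>"
    and L3: "\<lbrakk>p \<in> carrier P; q \<in> carrier P; x \<in> carrier V\<rbrakk> \<Longrightarrow>
      \<lbrace>p, q\<rbrace>\<^bsub>P\<^esub> \<triangleright> x = (p \<triangleright> (q \<triangleright> x)) \<ominus>\<^bsub>V\<^esub> (q \<triangleright> (p \<triangleright> x)) \<oplus>\<^bsub>V\<^esub> \<lbrace>x, f p q\<rbrace>\<^bsub>V\<^esub>"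
    and L4: "\<lbrakk>p \<in> carrier P; q \<in> carrier P; r \<in> carrier P\<rbrakk> \<Longrightarrow>
      f p \<lbrace>q, r\<rbrace>\<^bsub>P\<^esub> \<oplus>\<^bsub>V\<^esub> f q \<lbrace>r, p\<rbrace>\<^bsub>P\<^esub> \<oplus>\<^bsub>V\<^esub> f r \<lbrace>p, q\<rbrace>\<^bsub>P\<^esub>
        \<oplus>\<^bsub>V\<^esub> (p \<triangleright> f q r) \<oplus>\<^bsub>V\<^esub> (q \<triangleright> f r p) \<oplus>\<^bsub>V\<^esub> (r \<triangleright> f p q) = \<zero>\<^bsub>V\<^esub>"
    and P1: "\<lbrakk>p \<in> carrier P; q \<in> carrier P; r \<in> carrier P\<rbrakk> \<Longrightarrow>
      f (p \<otimes>\<^bsub>P\<^esub> q) r \<ominus>\<^bsub>V\<^esub> (f p r \<triangleleft> q) \<ominus>\<^bsub>V\<^esub> (p \<rightharpoonup> f q r)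
        = (r \<triangleright> \<theta> p q) \<oplus>\<^bsub>V\<^esub> \<theta> \<lbrace>p, r\<rbrace>\<^bsub>P\<^esub> q \<oplus>\<^bsub>V\<^esub> \<theta> p \<lbrace>q, r\<rbrace>\<^bsub>P\<^esub>"
    and P2: "\<lbrakk>p \<in> carrier P; q \<in> carrier P; x \<in> carrier V\<rbrakk> \<Longrightarrow>
      (p \<otimes>\<^bsub>P\<^esub> q) \<triangleright> x = (p \<rightharpoonup> (q \<triangleright> x)) \<oplus>\<^bsub>V\<^esub> ((p \<triangleright> x) \<triangleleft> q) \<ominus>\<^bsub>V\<^esub> \<lbrace>\<theta> p q, x\<rbrace>\<^bsub>V\<^esub>"
    and P3: "\<lbrakk>p \<in> carrier P; q \<in> carrier P; x \<in> carrier V\<rbrakk> \<Longrightarrow>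
      \<lbrace>p, q\<rbrace>\<^bsub>P\<^esub> \<rightharpoonup> x = (p \<rightharpoonup> (q \<triangleright> x)) \<ominus>\<^bsub>V\<^esub> (q \<triangleright> (p \<rightharpoonup> x)) \<ominus>\<^bsub>V\<^esub> (f p q \<otimes>\<^bsub>V\<^esub> x)"
    and P4: "\<lbrakk>p \<in> carrier P; x \<in> carrier V; y \<in> carrier V\<rbrakk> \<Longrightarrow>
      p \<rightharpoonup> \<lbrace>x, y\<rbrace>\<^bsub>V\<^esub> = \<lbrace>p \<rightharpoonup> x, y\<rbrace>\<^bsub>V\<^esub> \<ominus>\<^bsub>V\<^esub> ((p \<triangleright> y) \<otimes>\<^bsub>V\<^esub> x)"
    and P5: "\<lbrakk>p \<in> carrier P; q \<in> carrier P; x \<in> carrier V\<rbrakk> \<Longrightarrow>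
      x \<triangleleft> \<lbrace>p, q\<rbrace>\<^bsub>P\<^esub> = ((q \<triangleright> x) \<triangleleft> p) \<ominus>\<^bsub>V\<^esub> (q \<triangleright> (x \<triangleleft> p)) \<ominus>\<^bsub>V\<^esub> (x \<otimes>\<^bsub>V\<^esub> f p q)"
    and P6: "\<lbrakk>p \<in> carrier P; x \<in> carrier V; y \<in> carrier V\<rbrakk> \<Longrightarrow>
      \<lbrace>x, y\<rbrace>\<^bsub>V\<^esub> \<triangleleft> p = \<lbrace>x \<triangleleft> p, y\<rbrace>\<^bsub>V\<^esub> \<ominus>\<^bsub>V\<^esub> (x \<otimes>\<^bsub>V\<^esub> (p \<triangleright> y))"
    and P7: "\<lbrakk>p \<in> carrier P; x \<in> carrier V; y \<in> carrier V\<rbrakk> \<Longrightarrow>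
      p \<triangleright> (x \<otimes>\<^bsub>V\<^esub> y) = ((p \<triangleright> x) \<otimes>\<^bsub>V\<^esub> y) \<oplus>\<^bsub>V\<^esub> (x \<otimes>\<^bsub>V\<^esub> (p \<triangleright> y))"

text \<open>A local crossed system as a 5-tuple \<open>(\<rightharpoonup>, \<triangleleft>, \<theta>, \<triangleright>, f)\<close>.\<close>

type_synonym ('p, 'v) local_data =
  "('p \<Rightarrow> 'v \<Rightarrow> 'v) \<times> ('v \<Rightarrow> 'p \<Rightarrow> 'v) \<times> ('p \<Rightarrow> 'p \<Rightarrow> 'v) \<times> ('p \<Rightarrow> 'v \<Rightarrow> 'v) \<times> ('p \<Rightarrow> 'p \<Rightarrow> 'v)"

definition LPS ::
  "('k, 'm) ring_scheme \<Rightarrow> ('k, 'p) poisson \<Rightarrow> ('k, 'v) poisson \<Rightarrow> ('p, 'v) local_data set"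
  where "LPS K P V = {(la, ra, \<theta>, tr, f). local_crossed_system K P V la ra \<theta> tr f}"

definition local_cohom ::
  "('k, 'm) ring_scheme \<Rightarrow> ('k, 'p) poisson \<Rightarrow> ('k, 'v) poisson \<Rightarrow>
   (('p, 'v) local_data \<times> ('p, 'v) local_data) set"
  where "local_cohom K P V =
    {((la, ra, \<theta>, tr, f), (la', ra', \<theta>', tr', f')).
       (la, ra, \<theta>, tr, f) \<in> LPS K P V \<and> (la', ra', \<theta>', tr', f') \<in> LPS K P V \<and>
       (\<exists>r\<in>lin_hom K P V. \<forall>p\<in>carrier P. \<forall>q\<in>carrier P. \<forall>x\<in>carrier V.
          la p x = la' p x \<oplus>\<^bsub>V\<^esub> r p \<otimes>\<^bsub>V\<^esub> x \<and>
          ra x p = ra' x p \<oplus>\<^bsub>V\<^esub> x \<otimes>\<^bsub>V\<^esub> r p \<and>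
          \<theta> p q = \<theta>' p q \<oplus>\<^bsub>V\<^esub> la' p (r q) \<oplus>\<^bsub>V\<^esub> ra' (r p) q \<ominus>\<^bsub>V\<^esub> r (p \<otimes>\<^bsub>P\<^esub> q) \<oplus>\<^bsub>V\<^esub> r p \<otimes>\<^bsub>V\<^esub> r q \<and>
          tr p x = tr' p x \<oplus>\<^bsub>V\<^esub> \<lbrace>r p, x\<rbrace>\<^bsub>V\<^esub> \<and>
          f p q = f' p q \<oplus>\<^bsub>V\<^esub> tr' p (r q) \<ominus>\<^bsub>V\<^esub> tr' q (r p) \<oplus>\<^bsub>V\<^esub> \<lbrace>r p, r q\<rbrace>\<^bsub>V\<^esub> \<ominus>\<^bsub>V\<^esub> r \<lbrace>p, q\<rbrace>\<^bsub>P\<^esub>)}"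

definition PH2 ::
  "('k, 'm) ring_scheme \<Rightarrow> ('k, 'p) poisson \<Rightarrow> ('k, 'v) poisson \<Rightarrow> ('p, 'v) local_data set set"
  where "PH2 K P V = LPS K P V // local_cohom K P V"


section \<open>Extensions and the crossed product\<close>

text \<open>An extension \<open>0 \<rightarrow> V \<rightarrow> E \<rightarrow> P \<rightarrow> 0\<close> as a triple \<open>(E, i, p)\<close>.\<close>

type_synonym ('k, 'p, 'v, 'e) ext_data =
  "('k, 'e) poisson \<times> ('v \<Rightarrow> 'e) \<times> ('e \<Rightarrow> 'p)"

definition extensions ::
  "('k, 'm) ring_scheme \<Rightarrow> ('k, 'p) poisson \<Rightarrow> ('k, 'v) poisson \<Rightarrow> ('k, 'p, 'v, 'e) ext_data set"
  where "extensions K P V =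
    {(E, i, p). poisson_algebra K E \<and> i \<in> poisson_hom K V E \<and> p \<in> poisson_hom K E P \<and>
       inj_on i (carrier V) \<and> i ` carrier V = a_kernel E P p \<and> p ` carrier E = carrier P}"

text \<open>The two middle terms may live on different types.\<close>

definition ext_equiv ::
  "('k, 'm) ring_scheme \<Rightarrow> ('k, 'p) poisson \<Rightarrow> ('k, 'v) poisson \<Rightarrow>
   (('k, 'p, 'v, 'e) ext_data \<times> ('k, 'p, 'v, 'e') ext_data) set"
  where "ext_equiv K P V =
    {((E, i, p), (E', i', p')).
       (E, i, p) \<in> extensions K P V \<and> (E', i', p') \<in> extensions K P V \<and>
       (\<exists>\<phi>\<in>poisson_hom K E E'. bij_betw \<phi> (carrier E) (carrier E') \<and>
          (\<forall>x\<in>carrier V. \<phi> (i x) = i' x) \<and> (\<forall>e\<in>carrier E. p' (\<phi> e) = p e))}"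

text \<open>
  The middle terms range over Poisson algebras whose carrier is an arbitrary subset of a fixed
  type; the type \<open>'p \<times> 'v\<close> is large enough for every extension of \<open>P\<close> by \<open>V\<close>.
\<close>

definition Ext ::
  "('k, 'm) ring_scheme \<Rightarrow> ('k, 'p) poisson \<Rightarrow> ('k, 'v) poisson \<Rightarrow>
   ('k, 'p, 'v, 'p \<times> 'v) ext_data set set"
  where "Ext K P V = extensions K P V // ext_equiv K P V"

definition crossed_product ::
  "('k, 'p) poisson \<Rightarrow> ('k, 'v) poisson \<Rightarrow> ('p, 'v) local_data \<Rightarrow> ('k, 'p \<times> 'v) poisson"
  where "crossed_product P V = (\<lambda>(la, ra, \<theta>, tr, f).
    \<lparr>carrier = carrier P \<times> carrier V,
     mult = (\<lambda>(p, x) (q, y). (p \<otimes>\<^bsub>P\<^esub> q, \<theta> p q \<oplus>\<^bsub>V\<^esub> la p y \<oplus>\<^bsub>V\<^esub> ra x q \<oplus>\<^bsub>V\<^esub> x \<otimes>\<^bsub>V\<^esub> y)),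
     one = undefined,
     zero = (\<zero>\<^bsub>P\<^esub>, \<zero>\<^bsub>V\<^esub>),
     add = (\<lambda>(p, x) (q, y). (p \<oplus>\<^bsub>P\<^esub> q, x \<oplus>\<^bsub>V\<^esub> y)),
     smult = (\<lambda>c (p, x). (c \<odot>\<^bsub>P\<^esub> p, c \<odot>\<^bsub>V\<^esub> x)),
     pbracket = (\<lambda>(p, x) (q, y). (\<lbrace>p, q\<rbrace>\<^bsub>P\<^esub>, f p q \<oplus>\<^bsub>V\<^esub> tr p y \<ominus>\<^bsub>V\<^esub> tr q x \<oplus>\<^bsub>V\<^esub> \<lbrace>x, y\<rbrace>\<^bsub>V\<^esub>))\<rparr>)"

definition crossed_product_ext ::
  "('k, 'p) poisson \<Rightarrow> ('k, 'v) poisson \<Rightarrow> ('p, 'v) local_data \<Rightarrow> ('k, 'p, 'v, 'p \<times> 'v) ext_data"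
  where "crossed_product_ext P V c = (crossed_product P V c, (\<lambda>x. (\<zero>\<^bsub>P\<^esub>, x)), fst)"


section \<open>Crossed systems of a Poisson algebra by a vector space\<close>

text \<open>A crossed system as a 7-tuple \<open>(\<rightharpoonup>, \<triangleleft>, \<theta>, \<cdot>, \<triangleright>, f, [-,-])\<close>.\<close>

type_synonym ('p, 'v) crossed_data =
  "('p \<Rightarrow> 'v \<Rightarrow> 'v) \<times> ('v \<Rightarrow> 'p \<Rightarrow> 'v) \<times> ('p \<Rightarrow> 'p \<Rightarrow> 'v) \<times> ('v \<Rightarrow> 'v \<Rightarrow> 'v) \<times>
   ('p \<Rightarrow> 'v \<Rightarrow> 'v) \<times> ('p \<Rightarrow> 'p \<Rightarrow> 'v) \<times> ('v \<Rightarrow> 'v \<Rightarrow> 'v)"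

definition crossed_systems ::
  "('k, 'm) ring_scheme \<Rightarrow> ('k, 'p) poisson \<Rightarrow> ('k, 'v, 'n) module_scheme \<Rightarrow>
   ('p, 'v) crossed_data set"
  where "crossed_systems K P V =
    {(la, ra, \<theta>, m, tr, f, b).
       (m, b) \<in> poisson_structures K V \<and> (la, ra, \<theta>, tr, f) \<in> LPS K P (with_poisson V m b)}"

definition cohom ::
  "('k, 'm) ring_scheme \<Rightarrow> ('k, 'p) poisson \<Rightarrow> ('k, 'v, 'n) module_scheme \<Rightarrow>
   (('p, 'v) crossed_data \<times> ('p, 'v) crossed_data) set"
  where "cohom K P V =
    {((la, ra, \<theta>, m, tr, f, b), (la', ra', \<theta>', m', tr', f', b')).
       (la, ra, \<theta>, m, tr, f, b) \<in> crossed_systems K P V \<and>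
       (la', ra', \<theta>', m', tr', f', b') \<in> crossed_systems K P V \<and>
       m = m' \<and> b = b' \<and>
       ((la, ra, \<theta>, tr, f), (la', ra', \<theta>', tr', f')) \<in> local_cohom K P (with_poisson V m b)}"

definition GPH2 ::
  "('k, 'm) ring_scheme \<Rightarrow> ('k, 'p) poisson \<Rightarrow> ('k, 'v, 'n) module_scheme \<Rightarrow>
   ('p, 'v) crossed_data set set"
  where "GPH2 K P V = crossed_systems K P V // cohom K P V"

definition assemble ::
  "('v \<Rightarrow> 'v \<Rightarrow> 'v) \<times> ('v \<Rightarrow> 'v \<Rightarrow> 'v) \<Rightarrow> ('p, 'v) local_data \<Rightarrow> ('p, 'v) crossed_data"
  where "assemble = (\<lambda>(m, b) (la, ra, \<theta>, tr, f). (la, ra, \<theta>, m, tr, f, b))"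

end

theory Submission
  imports Defs
begin

text \<open>
  A local crossed system is five bilinear maps subject to identities, and these identities say
  exactly that the crossed product on \<open>P \<times> V\<close> is a Poisson algebra.  Indeed associativity,
  the Jacobi identity and the Leibniz rule are trilinear, so they hold as soon as they hold when
  each argument lies in \<open>P \<times> 0\<close> or in \<open>0 \<times> V\<close>, and the cases that arise are the axioms
  (\<open>poisson_algebra_crossed_product\<close>, \<open>local_crossed_system_if_poisson_algebra\<close>).

  In the same way, cohomologous systems are those with equivalent crossed products
  (\<open>local_cohom_iff_ext_equiv\<close>): a linear automorphism of \<open>P \<times> V\<close> that fixes \<open>V\<close> and induces the
  identity on \<open>P\<close> is a shear \<open>(p, x) \<mapsto> (p, r p + x)\<close> with \<open>r\<close> linear, and it is a morphism
  between two crossed products iff \<open>r\<close> satisfies the five coboundary relations.  So cohomology is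
  the preimage of equivalence of extensions under the crossed product construction.  It is
  therefore an equivalence relation, and the induced map on classes is well defined and injective.

  The map is surjective because every extension \<open>E\<close> is equivalent to a crossed product
  (\<open>extension_equiv_crossed_product\<close>).  A linear section \<open>s\<close> of \<open>E \<rightarrow> P\<close>, which exists by Zorn's
  lemma, gives a linear isomorphism \<open>P \<times> V \<cong> E\<close>; transporting the operations of \<open>E\<close> along it
  yields a Poisson algebra of crossed product form, hence a crossed system.  This construction
  also shows that extensions with middle terms on any type are represented on \<open>'p \<times> 'v\<close>.

  For the second part, cohomologous 7-tuples share their Poisson structure on \<open>V\<close>, so the classes
  of 7-tuples with a given structure are the local classes for that structure.
\<close>

section \<open>Linear and bilinear maps\<close>

lemma lin_homI:
  assumes "\<And>x. x \<in> carrier A \<Longrightarrow> h x \<in> carrier B"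
    and "\<And>x y. \<lbrakk>x \<in> carrier A; y \<in> carrier A\<rbrakk> \<Longrightarrow> h (x \<oplus>\<^bsub>A\<^esub> y) = h x \<oplus>\<^bsub>B\<^esub> h y"
    and "\<And>c x. \<lbrakk>c \<in> carrier K; x \<in> carrier A\<rbrakk> \<Longrightarrow> h (c \<odot>\<^bsub>A\<^esub> x) = c \<odot>\<^bsub>B\<^esub> h x"
  shows "h \<in> lin_hom K A B"
  using assms by (auto simp: lin_hom_def)

lemma lin_hom_rules:
  assumes "module K A" "module K B" "h \<in> lin_hom K A B"
  shows "x \<in> carrier A \<Longrightarrow> h x \<in> carrier B"
    and "\<lbrakk>x \<in> carrier A; y \<in> carrier A\<rbrakk> \<Longrightarrow> h (x \<oplus>\<^bsub>A\<^esub> y) = h x \<oplus>\<^bsub>B\<^esub> h y"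
    and "\<lbrakk>c \<in> carrier K; x \<in> carrier A\<rbrakk> \<Longrightarrow> h (c \<odot>\<^bsub>A\<^esub> x) = c \<odot>\<^bsub>B\<^esub> h x"
    and "h \<zero>\<^bsub>A\<^esub> = \<zero>\<^bsub>B\<^esub>"
    and "x \<in> carrier A \<Longrightarrow> h (\<ominus>\<^bsub>A\<^esub> x) = \<ominus>\<^bsub>B\<^esub> h x"
proof -
  interpret A: module K A by fact
  interpret B: module K B by fact
  show cl: "x \<in> carrier A \<Longrightarrow> h x \<in> carrier B" for x
    using assms by (auto simp: lin_hom_def)
  show ad: "\<lbrakk>x \<in> carrier A; y \<in> carrier A\<rbrakk> \<Longrightarrow> h (x \<oplus>\<^bsub>A\<^esub> y) = h x \<oplus>\<^bsub>B\<^esub> h y" for x y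
    using assms by (auto simp: lin_hom_def)
  show "\<lbrakk>c \<in> carrier K; x \<in> carrier A\<rbrakk> \<Longrightarrow> h (c \<odot>\<^bsub>A\<^esub> x) = c \<odot>\<^bsub>B\<^esub> h x"
    using assms by (auto simp: lin_hom_def)
  show z: "h \<zero>\<^bsub>A\<^esub> = \<zero>\<^bsub>B\<^esub>"
    using ad[of "\<zero>\<^bsub>A\<^esub>" "\<zero>\<^bsub>A\<^esub>"] cl[of "\<zero>\<^bsub>A\<^esub>"] B.add.r_cancel_one' by fastforce
  show "h (\<ominus>\<^bsub>A\<^esub> x) = \<ominus>\<^bsub>B\<^esub> h x" if "x \<in> carrier A"
    using ad[of "\<ominus>\<^bsub>A\<^esub> x" x] cl that z
    by (metis A.a_inv_closed A.l_neg B.minus_equality)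
qed

lemma lin_hom_compose:
  "\<lbrakk>g \<in> lin_hom K A B; h \<in> lin_hom K B C\<rbrakk> \<Longrightarrow> (\<lambda>x. h (g x)) \<in> lin_hom K A C"
  by (auto simp: lin_hom_def Pi_iff)

lemma lin_hom_diff:
  assumes "module K A" "module K B" and g: "g \<in> lin_hom K A B" and h: "h \<in> lin_hom K A B"
  shows "(\<lambda>x. g x \<ominus>\<^bsub>B\<^esub> h x) \<in> lin_hom K A B"
proof -
  interpret A: module K A by fact
  interpret B: module K B by fact
  note [simp] = lin_hom_rules[OF assms(1,2) g] lin_hom_rules[OF assms(1,2) h]
  show ?thesis
    by (rule lin_homI) (simp_all add: B.minus_eq B.minus_add B.a_ac B.smult_r_distr B.smult_r_minus)
qed

lemma bilinear_rules:
  assumes "module K A" "module K B" "module K C" "bilinear K A B C h"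
  shows "\<lbrakk>x \<in> carrier A; y \<in> carrier B\<rbrakk> \<Longrightarrow> h x y \<in> carrier C"
    and "\<lbrakk>x \<in> carrier A; x' \<in> carrier A; y \<in> carrier B\<rbrakk> \<Longrightarrow> h (x \<oplus>\<^bsub>A\<^esub> x') y = h x y \<oplus>\<^bsub>C\<^esub> h x' y"
    and "\<lbrakk>x \<in> carrier A; y \<in> carrier B; y' \<in> carrier B\<rbrakk> \<Longrightarrow> h x (y \<oplus>\<^bsub>B\<^esub> y') = h x y \<oplus>\<^bsub>C\<^esub> h x y'"
    and "\<lbrakk>c \<in> carrier K; x \<in> carrier A; y \<in> carrier B\<rbrakk> \<Longrightarrow> h (c \<odot>\<^bsub>A\<^esub> x) y = c \<odot>\<^bsub>C\<^esub> h x y"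
    and "\<lbrakk>c \<in> carrier K; x \<in> carrier A; y \<in> carrier B\<rbrakk> \<Longrightarrow> h x (c \<odot>\<^bsub>B\<^esub> y) = c \<odot>\<^bsub>C\<^esub> h x y"
    and "y \<in> carrier B \<Longrightarrow> h \<zero>\<^bsub>A\<^esub> y = \<zero>\<^bsub>C\<^esub>"
    and "x \<in> carrier A \<Longrightarrow> h x \<zero>\<^bsub>B\<^esub> = \<zero>\<^bsub>C\<^esub>"
    and "\<lbrakk>x \<in> carrier A; y \<in> carrier B\<rbrakk> \<Longrightarrow> h (\<ominus>\<^bsub>A\<^esub> x) y = \<ominus>\<^bsub>C\<^esub> h x y"
    and "\<lbrakk>x \<in> carrier A; y \<in> carrier B\<rbrakk> \<Longrightarrow> h x (\<ominus>\<^bsub>B\<^esub> y) = \<ominus>\<^bsub>C\<^esub> h x y"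
proof -
  have L: "h x \<in> lin_hom K B C" if "x \<in> carrier A" for x
    using assms(4) that by (simp add: bilinear_def)
  have R: "(\<lambda>x. h x y) \<in> lin_hom K A C" if "y \<in> carrier B" for y
    using assms(4) that by (simp add: bilinear_def)
  note l = lin_hom_rules[OF assms(2,3) L]
  note r = lin_hom_rules[OF assms(1,3) R]
  show "\<lbrakk>x \<in> carrier A; y \<in> carrier B\<rbrakk> \<Longrightarrow> h x y \<in> carrier C" by (rule l(1))
  show "\<lbrakk>x \<in> carrier A; x' \<in> carrier A; y \<in> carrier B\<rbrakk> \<Longrightarrow> h (x \<oplus>\<^bsub>A\<^esub> x') y = h x y \<oplus>\<^bsub>C\<^esub> h x' y"
    by (rule r(2))
  show "\<lbrakk>x \<in> carrier A; y \<in> carrier B; y' \<in> carrier B\<rbrakk> \<Longrightarrow> h x (y \<oplus>\<^bsub>B\<^esub> y') = h x y \<oplus>\<^bsub>C\<^esub> h x y'"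
    by (rule l(2))
  show "\<lbrakk>c \<in> carrier K; x \<in> carrier A; y \<in> carrier B\<rbrakk> \<Longrightarrow> h (c \<odot>\<^bsub>A\<^esub> x) y = c \<odot>\<^bsub>C\<^esub> h x y"
    by (rule r(3))
  show "\<lbrakk>c \<in> carrier K; x \<in> carrier A; y \<in> carrier B\<rbrakk> \<Longrightarrow> h x (c \<odot>\<^bsub>B\<^esub> y) = c \<odot>\<^bsub>C\<^esub> h x y"
    by (rule l(3))
  show "y \<in> carrier B \<Longrightarrow> h \<zero>\<^bsub>A\<^esub> y = \<zero>\<^bsub>C\<^esub>" by (rule r(4))
  show "x \<in> carrier A \<Longrightarrow> h x \<zero>\<^bsub>B\<^esub> = \<zero>\<^bsub>C\<^esub>" by (rule l(4))
  show "\<lbrakk>x \<in> carrier A; y \<in> carrier B\<rbrakk> \<Longrightarrow> h (\<ominus>\<^bsub>A\<^esub> x) y = \<ominus>\<^bsub>C\<^esub> h x y" by (rule r(5))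
  show "\<lbrakk>x \<in> carrier A; y \<in> carrier B\<rbrakk> \<Longrightarrow> h x (\<ominus>\<^bsub>B\<^esub> y) = \<ominus>\<^bsub>C\<^esub> h x y" by (rule l(5))
qed

lemma bilinear_compose:
  assumes "bilinear K A B C h" "g \<in> lin_hom K A' A" "g' \<in> lin_hom K B' B"
  shows "bilinear K A' B' C (\<lambda>x y. h (g x) (g' y))"
proof -
  have "g x \<in> carrier A" if "x \<in> carrier A'" for x using assms(2) that by (auto simp: lin_hom_def)
  moreover have "g' y \<in> carrier B" if "y \<in> carrier B'" for y
    using assms(3) that by (auto simp: lin_hom_def)
  ultimately show ?thesis
    using assms by (auto simp: bilinear_def intro: lin_hom_compose[of g'] lin_hom_compose[of g _ _ _ "\<lambda>x. h x _"])
qed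

lemma lin_hom_compose_bilinear:
  assumes "bilinear K A B C h" "g \<in> lin_hom K C D"
  shows "bilinear K A B D (\<lambda>x y. g (h x y))"
  using assms by (auto simp: bilinear_def intro: lin_hom_compose)

lemma bilinear_diff:
  assumes "module K A" "module K B" "module K C" "bilinear K A B C g" "bilinear K A B C h"
  shows "bilinear K A B C (\<lambda>x y. g x y \<ominus>\<^bsub>C\<^esub> h x y)"
  using assms by (auto simp: bilinear_def intro: lin_hom_diff)

section \<open>Checking identities on generators\<close>

text \<open>
  The crossed product is a direct sum of two submodules.  Taking \<open>G\<close> to be their union, an
  identity between multiadditive maps needs to be checked only when every argument is a pure
  element of one of the two summands.
\<close>

definition sum_decomposes :: "('k, 'a, 'n) module_scheme \<Rightarrow> 'a set \<Rightarrow> bool"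
  where "sum_decomposes A G \<longleftrightarrow>
    G \<subseteq> carrier A \<and> (\<forall>a\<in>carrier A. \<exists>u\<in>G. \<exists>v\<in>G. a = u \<oplus>\<^bsub>A\<^esub> v)"

lemma bilinear_eqI:
  assumes "module K A" "module K C" and "bilinear K A A C g" and "bilinear K A A C h"
    and G: "sum_decomposes A G"
    and "\<And>u v. \<lbrakk>u \<in> G; v \<in> G\<rbrakk> \<Longrightarrow> g u v = h u v"
    and a: "a \<in> carrier A" "b \<in> carrier A"
  shows "g a b = h a b"
proof -
  obtain u u' where u: "u \<in> G" "u' \<in> G" "a = u \<oplus>\<^bsub>A\<^esub> u'" using G a by (auto simp: sum_decomposes_def)
  obtain v v' where v: "v \<in> G" "v' \<in> G" "b = v \<oplus>\<^bsub>A\<^esub> v'" using G a by (auto simp: sum_decomposes_def)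
  interpret A: module K A by fact
  have *: "u \<in> carrier A" "u' \<in> carrier A" "v \<in> carrier A" "v' \<in> carrier A"
    using u v G by (auto simp: sum_decomposes_def)
  show ?thesis using * u v assms(6)
    by (simp add: bilinear_rules[OF assms(1,1,2,3)] bilinear_rules[OF assms(1,1,2,4)])
qed

definition triadditive ::
  "('k, 'a, 'n) module_scheme \<Rightarrow> ('a \<Rightarrow> 'a \<Rightarrow> 'a \<Rightarrow> 'a) \<Rightarrow> bool"
  where "triadditive A F \<longleftrightarrow> (\<forall>a\<in>carrier A. \<forall>a'\<in>carrier A. \<forall>b\<in>carrier A. \<forall>c\<in>carrier A.
     F (a \<oplus>\<^bsub>A\<^esub> a') b c = F a b c \<oplus>\<^bsub>A\<^esub> F a' b c \<and>
     F b (a \<oplus>\<^bsub>A\<^esub> a') c = F b a c \<oplus>\<^bsub>A\<^esub> F b a' c \<and>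
     F b c (a \<oplus>\<^bsub>A\<^esub> a') = F b c a \<oplus>\<^bsub>A\<^esub> F b c a')"

lemma triadditive_eqI:
  assumes "module K A" and "triadditive A F" and "triadditive A F'"
    and G: "sum_decomposes A G"
    and "\<And>u v w. \<lbrakk>u \<in> G; v \<in> G; w \<in> G\<rbrakk> \<Longrightarrow> F u v w = F' u v w"
    and a: "a \<in> carrier A" "b \<in> carrier A" "c \<in> carrier A"
  shows "F a b c = F' a b c"
proof -
  obtain u u' where u: "u \<in> G" "u' \<in> G" "a = u \<oplus>\<^bsub>A\<^esub> u'" using G a by (auto simp: sum_decomposes_def)
  obtain v v' where v: "v \<in> G" "v' \<in> G" "b = v \<oplus>\<^bsub>A\<^esub> v'" using G a by (auto simp: sum_decomposes_def)
  obtain w w' where w: "w \<in> G" "w' \<in> G" "c = w \<oplus>\<^bsub>A\<^esub> w'" using G a by (auto simp: sum_decomposes_def)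
  interpret A: module K A by fact
  have *: "u \<in> carrier A" "u' \<in> carrier A" "v \<in> carrier A" "v' \<in> carrier A" "w \<in> carrier A" "w' \<in> carrier A"
    using u v w G by (auto simp: sum_decomposes_def)
  show ?thesis using * u v w assms(2,3,5)
    by (simp add: triadditive_def)
qed

text \<open>
  Both sides of associativity, of the Jacobi identity and of the Leibniz rule are triadditive, so
  \<open>G\<close> suffices for them.  The condition \<open>\<lbrace>u, u\<rbrace> = 0\<close> is quadratic instead; expanding
  \<open>\<lbrace>u + v, u + v\<rbrace>\<close> shows that it needs skew-symmetry on \<open>G\<close> as well.
\<close>

lemma poisson_algebra_from_generators:
  assumes "field K" and A: "module K A"
    and m: "bilinear K A A A (mult A)" and b: "bilinear K A A A (pbracket A)"
    and G: "sum_decomposes A G"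
    and ass: "\<And>u v w. \<lbrakk>u \<in> G; v \<in> G; w \<in> G\<rbrakk> \<Longrightarrow> (u \<otimes>\<^bsub>A\<^esub> v) \<otimes>\<^bsub>A\<^esub> w = u \<otimes>\<^bsub>A\<^esub> (v \<otimes>\<^bsub>A\<^esub> w)"
    and alt: "\<And>u. u \<in> G \<Longrightarrow> \<lbrace>u, u\<rbrace>\<^bsub>A\<^esub> = \<zero>\<^bsub>A\<^esub>"
    and skew: "\<And>u v. \<lbrakk>u \<in> G; v \<in> G\<rbrakk> \<Longrightarrow> \<lbrace>u, v\<rbrace>\<^bsub>A\<^esub> \<oplus>\<^bsub>A\<^esub> \<lbrace>v, u\<rbrace>\<^bsub>A\<^esub> = \<zero>\<^bsub>A\<^esub>"
    and jac: "\<And>u v w. \<lbrakk>u \<in> G; v \<in> G; w \<in> G\<rbrakk> \<Longrightarrow>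
      \<lbrace>u, \<lbrace>v, w\<rbrace>\<^bsub>A\<^esub>\<rbrace>\<^bsub>A\<^esub> \<oplus>\<^bsub>A\<^esub> \<lbrace>v, \<lbrace>w, u\<rbrace>\<^bsub>A\<^esub>\<rbrace>\<^bsub>A\<^esub> \<oplus>\<^bsub>A\<^esub> \<lbrace>w, \<lbrace>u, v\<rbrace>\<^bsub>A\<^esub>\<rbrace>\<^bsub>A\<^esub> = \<zero>\<^bsub>A\<^esub>"
    and leib: "\<And>u v w. \<lbrakk>u \<in> G; v \<in> G; w \<in> G\<rbrakk> \<Longrightarrow>
      \<lbrace>u \<otimes>\<^bsub>A\<^esub> v, w\<rbrace>\<^bsub>A\<^esub> = \<lbrace>u, w\<rbrace>\<^bsub>A\<^esub> \<otimes>\<^bsub>A\<^esub> v \<oplus>\<^bsub>A\<^esub> u \<otimes>\<^bsub>A\<^esub> \<lbrace>v, w\<rbrace>\<^bsub>A\<^esub>"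
  shows "poisson_algebra K A"
proof -
  interpret A: module K A by fact
  note [simp] = bilinear_rules[OF A A A m] bilinear_rules[OF A A A b]
  note tri = triadditive_eqI[OF A _ _ G]
  show ?thesis
  proof (intro poisson_algebra.intro poisson_algebra_axioms.intro)
    fix p q r assume pqr: "p \<in> carrier A" "q \<in> carrier A" "r \<in> carrier A"
    show "(p \<otimes>\<^bsub>A\<^esub> q) \<otimes>\<^bsub>A\<^esub> r = p \<otimes>\<^bsub>A\<^esub> (q \<otimes>\<^bsub>A\<^esub> r)"
      by (rule tri[of "\<lambda>p q r. (p \<otimes>\<^bsub>A\<^esub> q) \<otimes>\<^bsub>A\<^esub> r" "\<lambda>p q r. p \<otimes>\<^bsub>A\<^esub> (q \<otimes>\<^bsub>A\<^esub> r)"])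
        (simp_all add: triadditive_def ass pqr)
    show "\<lbrace>p, \<lbrace>q, r\<rbrace>\<^bsub>A\<^esub>\<rbrace>\<^bsub>A\<^esub> \<oplus>\<^bsub>A\<^esub> \<lbrace>q, \<lbrace>r, p\<rbrace>\<^bsub>A\<^esub>\<rbrace>\<^bsub>A\<^esub> \<oplus>\<^bsub>A\<^esub> \<lbrace>r, \<lbrace>p, q\<rbrace>\<^bsub>A\<^esub>\<rbrace>\<^bsub>A\<^esub> = \<zero>\<^bsub>A\<^esub>"
      by (rule tri[of "\<lambda>p q r. \<lbrace>p, \<lbrace>q, r\<rbrace>\<^bsub>A\<^esub>\<rbrace>\<^bsub>A\<^esub> \<oplus>\<^bsub>A\<^esub> \<lbrace>q, \<lbrace>r, p\<rbrace>\<^bsub>A\<^esub>\<rbrace>\<^bsub>A\<^esub> \<oplus>\<^bsub>A\<^esub> \<lbrace>r, \<lbrace>p, q\<rbrace>\<^bsub>A\<^esub>\<rbrace>\<^bsub>A\<^esub>"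
            "\<lambda>p q r. \<zero>\<^bsub>A\<^esub>"])
        (simp_all add: triadditive_def jac pqr A.a_ac)
    show "\<lbrace>p \<otimes>\<^bsub>A\<^esub> q, r\<rbrace>\<^bsub>A\<^esub> = \<lbrace>p, r\<rbrace>\<^bsub>A\<^esub> \<otimes>\<^bsub>A\<^esub> q \<oplus>\<^bsub>A\<^esub> p \<otimes>\<^bsub>A\<^esub> \<lbrace>q, r\<rbrace>\<^bsub>A\<^esub>"
      by (rule tri[of "\<lambda>p q r. \<lbrace>p \<otimes>\<^bsub>A\<^esub> q, r\<rbrace>\<^bsub>A\<^esub>"
            "\<lambda>p q r. \<lbrace>p, r\<rbrace>\<^bsub>A\<^esub> \<otimes>\<^bsub>A\<^esub> q \<oplus>\<^bsub>A\<^esub> p \<otimes>\<^bsub>A\<^esub> \<lbrace>q, r\<rbrace>\<^bsub>A\<^esub>"])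
        (simp_all add: triadditive_def leib pqr A.a_ac)
  next
    fix p assume "p \<in> carrier A"
    then obtain u v where u: "u \<in> G" "v \<in> G" "p = u \<oplus>\<^bsub>A\<^esub> v"
      using G by (auto simp: sum_decomposes_def)
    moreover have "u \<in> carrier A" "v \<in> carrier A" using u G by (auto simp: sum_decomposes_def)
    ultimately show "\<lbrace>p, p\<rbrace>\<^bsub>A\<^esub> = \<zero>\<^bsub>A\<^esub>"
      by (simp add: alt skew)
  qed fact+
qed

text \<open>
  An injective structure-preserving map reflects all identities.  This is how a crossed product is
  seen to be a Poisson algebra when it is modelled on a given extension.
\<close>

lemma poisson_algebra_of_injection:
  assumes "poisson_algebra K B" and "module K A"
    and mA: "bilinear K A A A (mult A)" and bA: "bilinear K A A A (pbracket A)"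
    and h: "h \<in> poisson_hom K A B" and inj: "inj_on h (carrier A)"
  shows "poisson_algebra K A"
proof -
  interpret B: poisson_algebra K B by fact
  interpret A: module K A by fact
  note A = A.module_axioms and B = B.module_axioms
  have lin: "h \<in> lin_hom K A B" using h by (simp add: poisson_hom_def)
  have hm: "h (x \<otimes>\<^bsub>A\<^esub> y) = h x \<otimes>\<^bsub>B\<^esub> h y" "h \<lbrace>x, y\<rbrace>\<^bsub>A\<^esub> = \<lbrace>h x, h y\<rbrace>\<^bsub>B\<^esub>"
    if "x \<in> carrier A" "y \<in> carrier A" for x y using that h by (auto simp: poisson_hom_def)
  note [simp] = bilinear_rules(1)[OF A A A mA] bilinear_rules(1)[OF A A A bA] lin_hom_rules[OF A B lin] hm
  have eq: "x = y" if "x \<in> carrier A" "y \<in> carrier A" "h x = h y" for x y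
    using inj that by (auto dest: inj_onD)
  show ?thesis
  proof (intro poisson_algebra.intro poisson_algebra_axioms.intro)
    show "field K" by (rule B.field_axioms)
  qed (rule A mA bA eq; simp add: B.mult_assoc B.bracket_alternating B.jacobi B.leibniz)+
qed

section \<open>The crossed product\<close>

lemma alternating_skew:
  assumes "module K A" "module K C" "bilinear K A A C h"
    and "\<And>x. x \<in> carrier A \<Longrightarrow> h x x = \<zero>\<^bsub>C\<^esub>" and "x \<in> carrier A" "y \<in> carrier A"
  shows "h x y \<oplus>\<^bsub>C\<^esub> h y x = \<zero>\<^bsub>C\<^esub>"
proof -
  interpret A: module K A by fact
  interpret C: module K C by fact
  note [simp] = bilinear_rules[OF assms(1,1,2,3)]
  have "h (x \<oplus>\<^bsub>A\<^esub> y) (x \<oplus>\<^bsub>A\<^esub> y) = h x x \<oplus>\<^bsub>C\<^esub> (h x y \<oplus>\<^bsub>C\<^esub> h y x) \<oplus>\<^bsub>C\<^esub> h y y"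
    using assms(5,6) by (simp add: C.a_ac)
  moreover have "h (x \<oplus>\<^bsub>A\<^esub> y) (x \<oplus>\<^bsub>A\<^esub> y) = \<zero>\<^bsub>C\<^esub>" using assms(4-6) by blast
  ultimately show ?thesis using assms(4-6) by simp
qed

lemma (in poisson_algebra) bracket_skew:
  "\<lbrakk>p \<in> carrier P; q \<in> carrier P\<rbrakk> \<Longrightarrow> \<lbrace>p, q\<rbrace>\<^bsub>P\<^esub> \<oplus>\<^bsub>P\<^esub> \<lbrace>q, p\<rbrace>\<^bsub>P\<^esub> = \<zero>\<^bsub>P\<^esub>"
  using alternating_skew[OF module_axioms module_axioms bracket_bilinear bracket_alternating] .

text \<open>
  The five bilinear maps alone, without the compatibility conditions.  They already determine a
  module with two bilinear operations, and the conditions turn out to say exactly that this module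
  is a Poisson algebra.
\<close>

locale crossed_datum = P: poisson_algebra K P + V: poisson_algebra K V
  for K :: "('k, 'm) ring_scheme" and P :: "('k, 'p) poisson" and V :: "('k, 'v) poisson" +
  fixes la :: "'p \<Rightarrow> 'v \<Rightarrow> 'v" and ra :: "'v \<Rightarrow> 'p \<Rightarrow> 'v" and \<theta> :: "'p \<Rightarrow> 'p \<Rightarrow> 'v"
    and tr :: "'p \<Rightarrow> 'v \<Rightarrow> 'v" and f :: "'p \<Rightarrow> 'p \<Rightarrow> 'v"
  assumes la: "la \<in> bilinear_maps K P V V" and ra: "ra \<in> bilinear_maps K V P V"
    and \<theta>: "\<theta> \<in> bilinear_maps K P P V" and tr: "tr \<in> bilinear_maps K P V V"
    and f: "f \<in> bilinear_maps K P P V"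
begin

lemma bilin: "bilinear K P V V la" "bilinear K V P V ra" "bilinear K P P V \<theta>"
  "bilinear K P V V tr" "bilinear K P P V f"
  using la ra \<theta> tr f by (auto simp: bilinear_maps_def)

lemmas modules = P.module_axioms V.module_axioms

lemmas rules [simp] =
  bilinear_rules[OF P.module_axioms P.module_axioms P.module_axioms P.mult_bilinear]
  bilinear_rules[OF P.module_axioms P.module_axioms P.module_axioms P.bracket_bilinear]
  bilinear_rules[OF V.module_axioms V.module_axioms V.module_axioms V.mult_bilinear]
  bilinear_rules[OF V.module_axioms V.module_axioms V.module_axioms V.bracket_bilinear]
  bilinear_rules[OF P.module_axioms V.module_axioms V.module_axioms bilin(1)]
  bilinear_rules[OF V.module_axioms P.module_axioms V.module_axioms bilin(2)]
  bilinear_rules[OF P.module_axioms P.module_axioms V.module_axioms bilin(3)]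
  bilinear_rules[OF P.module_axioms V.module_axioms V.module_axioms bilin(4)]
  bilinear_rules[OF P.module_axioms P.module_axioms V.module_axioms bilin(5)]

abbreviation "datum \<equiv> (la, ra, \<theta>, tr, f)"
abbreviation "E \<equiv> crossed_product P V datum"

lemma crossed_product_sel [simp]:
  "carrier E = carrier P \<times> carrier V"
  "(p, x) \<otimes>\<^bsub>E\<^esub> (q, y) = (p \<otimes>\<^bsub>P\<^esub> q, \<theta> p q \<oplus>\<^bsub>V\<^esub> la p y \<oplus>\<^bsub>V\<^esub> ra x q \<oplus>\<^bsub>V\<^esub> x \<otimes>\<^bsub>V\<^esub> y)"
  "\<lbrace>(p, x), (q, y)\<rbrace>\<^bsub>E\<^esub> = (\<lbrace>p, q\<rbrace>\<^bsub>P\<^esub>, f p q \<oplus>\<^bsub>V\<^esub> tr p y \<ominus>\<^bsub>V\<^esub> tr q x \<oplus>\<^bsub>V\<^esub> \<lbrace>x, y\<rbrace>\<^bsub>V\<^esub>)"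
  "(p, x) \<oplus>\<^bsub>E\<^esub> (q, y) = (p \<oplus>\<^bsub>P\<^esub> q, x \<oplus>\<^bsub>V\<^esub> y)"
  "c \<odot>\<^bsub>E\<^esub> (p, x) = (c \<odot>\<^bsub>P\<^esub> p, c \<odot>\<^bsub>V\<^esub> x)"
  "\<zero>\<^bsub>E\<^esub> = (\<zero>\<^bsub>P\<^esub>, \<zero>\<^bsub>V\<^esub>)"
  by (simp_all add: crossed_product_def)

lemma module_crossed_product: "module K E"
proof (rule moduleI)
  show "abelian_group E"
  proof (rule abelian_groupI)
    fix x assume "x \<in> carrier E"
    then obtain p v where "x = (p, v)" "p \<in> carrier P" "v \<in> carrier V" by auto
    then show "\<exists>y\<in>carrier E. y \<oplus>\<^bsub>E\<^esub> x = \<zero>\<^bsub>E\<^esub>"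
      by (intro bexI[of _ "(\<ominus>\<^bsub>P\<^esub> p, \<ominus>\<^bsub>V\<^esub> v)"]) (simp_all add: P.l_neg V.l_neg)
  qed (auto simp: P.a_ac V.a_ac)
qed (auto simp: P.is_cring P.smult_l_distr V.smult_l_distr P.smult_r_distr V.smult_r_distr
    P.smult_assoc1 V.smult_assoc1)

lemma bilinear_crossed_product:
  "bilinear K E E E (mult E)" "bilinear K E E E (pbracket E)"
  unfolding bilinear_def
  by (intro conjI ballI lin_homI; auto simp: V.a_ac V.minus_eq V.minus_add V.smult_r_distr V.smult_r_minus)+

definition homogeneous :: "('p \<times> 'v) set"
  where "homogeneous = (\<lambda>p. (p, \<zero>\<^bsub>V\<^esub>)) ` carrier P \<union> (\<lambda>x. (\<zero>\<^bsub>P\<^esub>, x)) ` carrier V"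

lemma sum_decomposes_homogeneous: "sum_decomposes E homogeneous"
  unfolding sum_decomposes_def
proof (intro conjI ballI)
  show "homogeneous \<subseteq> carrier E" by (auto simp: homogeneous_def)
  fix a assume "a \<in> carrier E"
  then obtain p x where "a = (p, \<zero>\<^bsub>V\<^esub>) \<oplus>\<^bsub>E\<^esub> (\<zero>\<^bsub>P\<^esub>, x)" "p \<in> carrier P" "x \<in> carrier V" by auto
  then show "\<exists>u\<in>homogeneous. \<exists>v\<in>homogeneous. a = u \<oplus>\<^bsub>E\<^esub> v"
    unfolding homogeneous_def by blast
qed

lemma minus_eq_iff:
  assumes "a \<in> carrier V" "b \<in> carrier V" "c \<in> carrier V"
  shows "b \<ominus>\<^bsub>V\<^esub> c = a \<longleftrightarrow> b = a \<oplus>\<^bsub>V\<^esub> c"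
  using assms V.minus_eq V.add.inv_solve_right by (metis V.a_closed V.add.inv_closed)

lemma minus_zero [simp]: "\<ominus>\<^bsub>V\<^esub> \<zero>\<^bsub>V\<^esub> = \<zero>\<^bsub>V\<^esub>"
  by (rule V.minus_equality) simp_all

lemma cancel [simp]:
  assumes "a \<in> carrier V" "b \<in> carrier V"
  shows "a \<oplus>\<^bsub>V\<^esub> (\<ominus>\<^bsub>V\<^esub> a \<oplus>\<^bsub>V\<^esub> b) = b" "a \<oplus>\<^bsub>V\<^esub> (b \<oplus>\<^bsub>V\<^esub> \<ominus>\<^bsub>V\<^esub> a) = b"
  using assms by (simp_all add: V.a_assoc[symmetric] V.r_neg V.a_comm[of b])

lemmas group_normalise = V.minus_eq V.minus_add V.a_ac V.r_neg V.l_neg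

lemma bracket_skew': "\<lbrakk>p \<in> carrier P; x \<in> carrier V; y \<in> carrier V\<rbrakk> \<Longrightarrow>
    \<lbrace>x, tr p y\<rbrace>\<^bsub>V\<^esub> = \<ominus>\<^bsub>V\<^esub> \<lbrace>tr p y, x\<rbrace>\<^bsub>V\<^esub>"
  by (rule V.minus_equality[symmetric]) (simp_all add: V.bracket_skew)

end

sublocale local_crossed_system \<subseteq> crossed_datum K P V lact ract \<theta> lie_act f
  by unfold_locales (fact lact ract theta lie_act f)+

context local_crossed_system
begin

lemma f_skew: "\<lbrakk>p \<in> carrier P; q \<in> carrier P\<rbrakk> \<Longrightarrow> f p q \<oplus>\<^bsub>V\<^esub> f q p = \<zero>\<^bsub>V\<^esub>"
  using alternating_skew[OF modules bilin(5) L1] .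

text \<open>
  P1 and L4 with their terms grouped as they occur when the Leibniz rule and the Jacobi identity
  are evaluated on three elements of \<open>P\<close>.
\<close>

lemma P1': "\<lbrakk>p \<in> carrier P; q \<in> carrier P; r \<in> carrier P\<rbrakk> \<Longrightarrow>
    f (p \<otimes>\<^bsub>P\<^esub> q) r \<ominus>\<^bsub>V\<^esub> (r \<triangleright> \<theta> p q) = \<theta> \<lbrace>p, r\<rbrace>\<^bsub>P\<^esub> q \<oplus>\<^bsub>V\<^esub> (f p r \<triangleleft> q) \<oplus>\<^bsub>V\<^esub> (\<theta> p \<lbrace>q, r\<rbrace>\<^bsub>P\<^esub> \<oplus>\<^bsub>V\<^esub> (p \<rightharpoonup> f q r))"
  using P1[of p q r] by (simp add: minus_eq_iff V.a_ac)

lemma L4': "\<lbrakk>p \<in> carrier P; q \<in> carrier P; r \<in> carrier P\<rbrakk> \<Longrightarrow>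
    (f p \<lbrace>q, r\<rbrace>\<^bsub>P\<^esub> \<oplus>\<^bsub>V\<^esub> (p \<triangleright> f q r)) \<oplus>\<^bsub>V\<^esub> (f q \<lbrace>r, p\<rbrace>\<^bsub>P\<^esub> \<oplus>\<^bsub>V\<^esub> (q \<triangleright> f r p)) \<oplus>\<^bsub>V\<^esub> (f r \<lbrace>p, q\<rbrace>\<^bsub>P\<^esub> \<oplus>\<^bsub>V\<^esub> (r \<triangleright> f p q)) = \<zero>\<^bsub>V\<^esub>"
  by (subst L4[of p q r, symmetric]) (simp_all add: V.a_ac)

text \<open>
  Each choice of summands for the three arguments reduces the identity in \<open>V\<close> to a single axiom: the eight
  cases of associativity are H1 to H7 and associativity of \<open>V\<close>, where H5 comes with associativity of
  \<open>P\<close> in the first component.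
\<close>

lemma assoc_homogeneous:
  assumes "u \<in> homogeneous" "v \<in> homogeneous" "w \<in> homogeneous"
  shows "(u \<otimes>\<^bsub>E\<^esub> v) \<otimes>\<^bsub>E\<^esub> w = u \<otimes>\<^bsub>E\<^esub> (v \<otimes>\<^bsub>E\<^esub> w)"
  using assms unfolding homogeneous_def
  by (elim UnE imageE;
      simp add: P.mult_assoc V.mult_assoc H1 H2 H3 H4 H5 H6 H7; simp add: group_normalise)

text \<open>
  The eight cases are P1 to P7 and the Leibniz rule of \<open>V\<close>, where P1 comes with the Leibniz rule
  of \<open>P\<close> in the first component.
\<close>

lemma leibniz_homogeneous:
  assumes "u \<in> homogeneous" "v \<in> homogeneous" "w \<in> homogeneous"
  shows "\<lbrace>u \<otimes>\<^bsub>E\<^esub> v, w\<rbrace>\<^bsub>E\<^esub> = \<lbrace>u, w\<rbrace>\<^bsub>E\<^esub> \<otimes>\<^bsub>E\<^esub> v \<oplus>\<^bsub>E\<^esub> u \<otimes>\<^bsub>E\<^esub> \<lbrace>v, w\<rbrace>\<^bsub>E\<^esub>"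
  using assms unfolding homogeneous_def
  by (elim UnE imageE;
      simp add: P.leibniz V.leibniz P1' P2 P3 P4 P5 P6 P7; simp add: group_normalise)

text \<open>
  The Jacobi identity is invariant under cyclic permutations, so its eight cases give only four
  conditions: L4, L3, L2 and the Jacobi identity of \<open>V\<close>.
\<close>

lemma jacobi_homogeneous:
  assumes "u \<in> homogeneous" "v \<in> homogeneous" "w \<in> homogeneous"
  shows "\<lbrace>u, \<lbrace>v, w\<rbrace>\<^bsub>E\<^esub>\<rbrace>\<^bsub>E\<^esub> \<oplus>\<^bsub>E\<^esub> \<lbrace>v, \<lbrace>w, u\<rbrace>\<^bsub>E\<^esub>\<rbrace>\<^bsub>E\<^esub> \<oplus>\<^bsub>E\<^esub> \<lbrace>w, \<lbrace>u, v\<rbrace>\<^bsub>E\<^esub>\<rbrace>\<^bsub>E\<^esub> = \<zero>\<^bsub>E\<^esub>"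
  using assms unfolding homogeneous_def
  by (elim UnE imageE;
      simp add: P.jacobi V.jacobi L2 L3 L4' bracket_skew' V.minus_eq; simp add: group_normalise)

lemma skew_homogeneous:
  assumes "u \<in> homogeneous" "v \<in> homogeneous"
  shows "\<lbrace>u, v\<rbrace>\<^bsub>E\<^esub> \<oplus>\<^bsub>E\<^esub> \<lbrace>v, u\<rbrace>\<^bsub>E\<^esub> = \<zero>\<^bsub>E\<^esub>"
  using assms unfolding homogeneous_def
  by (elim UnE imageE; simp add: P.bracket_skew V.bracket_skew f_skew V.minus_eq V.r_neg V.l_neg)

theorem poisson_algebra_crossed_product: "poisson_algebra K E"
proof (rule poisson_algebra_from_generators[OF _ module_crossed_product bilinear_crossed_product
      sum_decomposes_homogeneous])
  fix u assume "u \<in> homogeneous"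
  then show "\<lbrace>u, u\<rbrace>\<^bsub>E\<^esub> = \<zero>\<^bsub>E\<^esub>"
    by (auto simp: homogeneous_def P.bracket_alternating V.bracket_alternating L1 V.minus_eq)
qed (fact P.field_axioms assoc_homogeneous skew_homogeneous jacobi_homogeneous leibniz_homogeneous)+

end

context crossed_datum
begin

notation la (infixr "\<rightharpoonup>" 75) and ra (infixl "\<triangleleft>" 75) and tr (infixr "\<triangleright>" 75)

text \<open>
  In the use below, \<open>u = w\<close> is a Poisson identity of the crossed product evaluated on homogeneous
  elements, and \<open>a = b\<close> is an axiom whose terms are distributed differently over the two sides.
  Comparing differences avoids moving them one by one.
\<close>

lemma eq_from_difference:
  assumes "u = w" "a \<oplus>\<^bsub>V\<^esub> \<ominus>\<^bsub>V\<^esub> b = snd u \<oplus>\<^bsub>V\<^esub> \<ominus>\<^bsub>V\<^esub> snd w"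
    "a \<in> carrier V" "b \<in> carrier V" "u \<in> carrier E"
  shows "a = b"
  using assms minus_eq_iff[of "\<zero>\<^bsub>V\<^esub>" a b] by (auto simp: V.minus_eq V.r_neg)

text \<open>
  Conversely, the Poisson identities evaluated on homogeneous elements return the axioms one by
  one, since the product or bracket of two homogeneous elements involves only one of the structure
  maps in its second component.
\<close>

theorem local_crossed_system_if_poisson_algebra:
  assumes "poisson_algebra K E"
  shows "local_crossed_system K P V la ra \<theta> tr f"
proof -
  interpret E: poisson_algebra K E by fact
  let ?p = "\<lambda>p. (p, \<zero>\<^bsub>V\<^esub>)" and ?v = "\<lambda>x. (\<zero>\<^bsub>P\<^esub>, x)"
  note norm = group_normalise bracket_skew'
  show ?thesis
  proof (intro local_crossed_system.intro local_crossed_system_axioms.intro)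
    fix p x y assume a: "p \<in> carrier P" "x \<in> carrier V" "y \<in> carrier V"
    show "(x \<otimes>\<^bsub>V\<^esub> y) \<triangleleft> p = x \<otimes>\<^bsub>V\<^esub> (y \<triangleleft> p)"
      by (rule eq_from_difference[OF E.mult_assoc[of "?v x" "?v y" "?p p"]]) (simp_all add: a norm)
    show "(x \<triangleleft> p) \<otimes>\<^bsub>V\<^esub> y = x \<otimes>\<^bsub>V\<^esub> (p \<rightharpoonup> y)"
      by (rule eq_from_difference[OF E.mult_assoc[of "?v x" "?p p" "?v y"]]) (simp_all add: a norm)
    show "p \<rightharpoonup> (x \<otimes>\<^bsub>V\<^esub> y) = (p \<rightharpoonup> x) \<otimes>\<^bsub>V\<^esub> y"
      by (rule eq_from_difference[OF E.mult_assoc[of "?p p" "?v x" "?v y", symmetric]]) (simp_all add: a norm)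
    show "p \<triangleright> \<lbrace>x, y\<rbrace>\<^bsub>V\<^esub> = \<lbrace>p \<triangleright> x, y\<rbrace>\<^bsub>V\<^esub> \<oplus>\<^bsub>V\<^esub> \<lbrace>x, p \<triangleright> y\<rbrace>\<^bsub>V\<^esub>"
      by (rule eq_from_difference[OF E.jacobi[of "?p p" "?v x" "?v y"]]) (simp_all add: a norm)
    show "p \<rightharpoonup> \<lbrace>x, y\<rbrace>\<^bsub>V\<^esub> = \<lbrace>p \<rightharpoonup> x, y\<rbrace>\<^bsub>V\<^esub> \<ominus>\<^bsub>V\<^esub> ((p \<triangleright> y) \<otimes>\<^bsub>V\<^esub> x)"
      by (rule eq_from_difference[OF E.leibniz[of "?p p" "?v x" "?v y", symmetric]]) (simp_all add: a norm)
    show "\<lbrace>x, y\<rbrace>\<^bsub>V\<^esub> \<triangleleft> p = \<lbrace>x \<triangleleft> p, y\<rbrace>\<^bsub>V\<^esub> \<ominus>\<^bsub>V\<^esub> (x \<otimes>\<^bsub>V\<^esub> (p \<triangleright> y))"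
      by (rule eq_from_difference[OF E.leibniz[of "?v x" "?p p" "?v y", symmetric]]) (simp_all add: a norm)
    show "p \<triangleright> (x \<otimes>\<^bsub>V\<^esub> y) = ((p \<triangleright> x) \<otimes>\<^bsub>V\<^esub> y) \<oplus>\<^bsub>V\<^esub> (x \<otimes>\<^bsub>V\<^esub> (p \<triangleright> y))"
      by (rule eq_from_difference[OF E.leibniz[of "?v x" "?v y" "?p p", symmetric]]) (simp_all add: a norm)
  next
    fix p q x assume a: "p \<in> carrier P" "q \<in> carrier P" "x \<in> carrier V"
    show "(p \<rightharpoonup> x) \<triangleleft> q = p \<rightharpoonup> (x \<triangleleft> q)"
      by (rule eq_from_difference[OF E.mult_assoc[of "?p p" "?v x" "?p q"]]) (simp_all add: a norm)
    show "(p \<otimes>\<^bsub>P\<^esub> q) \<rightharpoonup> x = (p \<rightharpoonup> (q \<rightharpoonup> x)) \<ominus>\<^bsub>V\<^esub> (\<theta> p q \<otimes>\<^bsub>V\<^esub> x)"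
      by (rule eq_from_difference[OF E.mult_assoc[of "?p p" "?p q" "?v x"]]) (simp_all add: a norm)
    show "x \<triangleleft> (p \<otimes>\<^bsub>P\<^esub> q) = ((x \<triangleleft> p) \<triangleleft> q) \<ominus>\<^bsub>V\<^esub> (x \<otimes>\<^bsub>V\<^esub> \<theta> p q)"
      by (rule eq_from_difference[OF E.mult_assoc[of "?v x" "?p p" "?p q", symmetric]]) (simp_all add: a norm)
    show "\<lbrace>p, q\<rbrace>\<^bsub>P\<^esub> \<triangleright> x = (p \<triangleright> (q \<triangleright> x)) \<ominus>\<^bsub>V\<^esub> (q \<triangleright> (p \<triangleright> x)) \<oplus>\<^bsub>V\<^esub> \<lbrace>x, f p q\<rbrace>\<^bsub>V\<^esub>"
      by (rule eq_from_difference[OF E.jacobi[of "?v x" "?p p" "?p q", symmetric]]) (simp_all add: a norm)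
    show "(p \<otimes>\<^bsub>P\<^esub> q) \<triangleright> x = (p \<rightharpoonup> (q \<triangleright> x)) \<oplus>\<^bsub>V\<^esub> ((p \<triangleright> x) \<triangleleft> q) \<ominus>\<^bsub>V\<^esub> \<lbrace>\<theta> p q, x\<rbrace>\<^bsub>V\<^esub>"
      by (rule eq_from_difference[OF E.leibniz[of "?p p" "?p q" "?v x"]]) (simp_all add: a norm)
    show "\<lbrace>p, q\<rbrace>\<^bsub>P\<^esub> \<rightharpoonup> x = (p \<rightharpoonup> (q \<triangleright> x)) \<ominus>\<^bsub>V\<^esub> (q \<triangleright> (p \<rightharpoonup> x)) \<ominus>\<^bsub>V\<^esub> (f p q \<otimes>\<^bsub>V\<^esub> x)"
      by (rule eq_from_difference[OF E.leibniz[of "?p p" "?v x" "?p q", symmetric]]) (simp_all add: a norm)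
    show "x \<triangleleft> \<lbrace>p, q\<rbrace>\<^bsub>P\<^esub> = ((q \<triangleright> x) \<triangleleft> p) \<ominus>\<^bsub>V\<^esub> (q \<triangleright> (x \<triangleleft> p)) \<ominus>\<^bsub>V\<^esub> (x \<otimes>\<^bsub>V\<^esub> f p q)"
      by (rule eq_from_difference[OF E.leibniz[of "?v x" "?p p" "?p q", symmetric]]) (simp_all add: a norm)
  next
    fix p q r assume a: "p \<in> carrier P" "q \<in> carrier P" "r \<in> carrier P"
    show "(\<theta> p q) \<triangleleft> r = \<theta> p (q \<otimes>\<^bsub>P\<^esub> r) \<ominus>\<^bsub>V\<^esub> \<theta> (p \<otimes>\<^bsub>P\<^esub> q) r \<oplus>\<^bsub>V\<^esub> (p \<rightharpoonup> \<theta> q r)"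
      by (rule eq_from_difference[OF E.mult_assoc[of "?p p" "?p q" "?p r"]]) (simp_all add: a norm)
    show "f p \<lbrace>q, r\<rbrace>\<^bsub>P\<^esub> \<oplus>\<^bsub>V\<^esub> f q \<lbrace>r, p\<rbrace>\<^bsub>P\<^esub> \<oplus>\<^bsub>V\<^esub> f r \<lbrace>p, q\<rbrace>\<^bsub>P\<^esub> \<oplus>\<^bsub>V\<^esub> (p \<triangleright> f q r) \<oplus>\<^bsub>V\<^esub> (q \<triangleright> f r p) \<oplus>\<^bsub>V\<^esub> (r \<triangleright> f p q) = \<zero>\<^bsub>V\<^esub>"
      by (rule eq_from_difference[OF E.jacobi[of "?p p" "?p q" "?p r"]]) (simp_all add: a norm)
    show "f (p \<otimes>\<^bsub>P\<^esub> q) r \<ominus>\<^bsub>V\<^esub> (f p r \<triangleleft> q) \<ominus>\<^bsub>V\<^esub> (p \<rightharpoonup> f q r) = (r \<triangleright> \<theta> p q) \<oplus>\<^bsub>V\<^esub> \<theta> \<lbrace>p, r\<rbrace>\<^bsub>P\<^esub> q \<oplus>\<^bsub>V\<^esub> \<theta> p \<lbrace>q, r\<rbrace>\<^bsub>P\<^esub>"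
      by (rule eq_from_difference[OF E.leibniz[of "?p p" "?p q" "?p r"]]) (simp_all add: a norm)
  next
    fix p assume a: "p \<in> carrier P"
    show "f p p = \<zero>\<^bsub>V\<^esub>"
      by (rule eq_from_difference[OF E.bracket_alternating[of "?p p"]]) (simp_all add: a norm)
  qed (fact P.poisson_algebra_axioms V.poisson_algebra_axioms la ra \<theta> tr f)+
qed

end

section \<open>Cohomology as equivalence of crossed products\<close>

definition cohomologous_via ::
  "('k, 'p) poisson \<Rightarrow> ('k, 'v) poisson \<Rightarrow> ('p \<Rightarrow> 'v) \<Rightarrow> ('p, 'v) local_data \<Rightarrow> ('p, 'v) local_data \<Rightarrow> bool"
  where "cohomologous_via P V r = (\<lambda>(la, ra, \<theta>, tr, f) (la', ra', \<theta>', tr', f').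
    \<forall>p\<in>carrier P. \<forall>q\<in>carrier P. \<forall>x\<in>carrier V.
      la p x = la' p x \<oplus>\<^bsub>V\<^esub> r p \<otimes>\<^bsub>V\<^esub> x \<and>
      ra x p = ra' x p \<oplus>\<^bsub>V\<^esub> x \<otimes>\<^bsub>V\<^esub> r p \<and>
      \<theta> p q = \<theta>' p q \<oplus>\<^bsub>V\<^esub> la' p (r q) \<oplus>\<^bsub>V\<^esub> ra' (r p) q \<ominus>\<^bsub>V\<^esub> r (p \<otimes>\<^bsub>P\<^esub> q) \<oplus>\<^bsub>V\<^esub> r p \<otimes>\<^bsub>V\<^esub> r q \<and>
      tr p x = tr' p x \<oplus>\<^bsub>V\<^esub> \<lbrace>r p, x\<rbrace>\<^bsub>V\<^esub> \<and>
      f p q = f' p q \<oplus>\<^bsub>V\<^esub> tr' p (r q) \<ominus>\<^bsub>V\<^esub> tr' q (r p) \<oplus>\<^bsub>V\<^esub> \<lbrace>r p, r q\<rbrace>\<^bsub>V\<^esub> \<ominus>\<^bsub>V\<^esub> r \<lbrace>p, q\<rbrace>\<^bsub>P\<^esub>)"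

lemma local_cohom_iff:
  "(c, c') \<in> local_cohom K P V \<longleftrightarrow>
    c \<in> LPS K P V \<and> c' \<in> LPS K P V \<and> (\<exists>r\<in>lin_hom K P V. cohomologous_via P V r c c')"
  by (cases c; cases c') (simp add: local_cohom_def cohomologous_via_def)

text \<open>
  A linear bijection of \<open>P \<times> V\<close> that fixes \<open>V\<close> and induces the identity on \<open>P\<close> has to be of this
  form.
\<close>

definition shear :: "('k, 'v) poisson \<Rightarrow> ('p \<Rightarrow> 'v) \<Rightarrow> 'p \<times> 'v \<Rightarrow> 'p \<times> 'v"
  where "shear V r = (\<lambda>(p, x). (p, r p \<oplus>\<^bsub>V\<^esub> x))"

lemma shear_Pair [simp]: "shear V r (p, x) = (p, r p \<oplus>\<^bsub>V\<^esub> x)"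
  by (simp add: shear_def)

context crossed_datum
begin

lemma eq_diff_iff:
  assumes "a \<in> carrier V" "b \<in> carrier V" "c \<in> carrier V"
  shows "a = b \<ominus>\<^bsub>V\<^esub> c \<longleftrightarrow> c \<oplus>\<^bsub>V\<^esub> a = b"
  using minus_eq_iff[of a b c] assms by (auto simp: V.a_comm)

lemma eq_diff_sum_iff:
  assumes "a \<in> carrier V" "b \<in> carrier V" "c \<in> carrier V" "d \<in> carrier V"
  shows "a = b \<ominus>\<^bsub>V\<^esub> c \<oplus>\<^bsub>V\<^esub> d \<longleftrightarrow> c \<oplus>\<^bsub>V\<^esub> a = b \<oplus>\<^bsub>V\<^esub> d"
proof -
  have "b \<ominus>\<^bsub>V\<^esub> c \<oplus>\<^bsub>V\<^esub> d = b \<oplus>\<^bsub>V\<^esub> d \<ominus>\<^bsub>V\<^esub> c"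
    using assms by (simp add: V.minus_eq V.a_ac)
  then show ?thesis using eq_diff_iff[of a "b \<oplus>\<^bsub>V\<^esub> d" c] assms by simp
qed

lemma shear_lin_hom:
  assumes "crossed_datum K P V la' ra' \<theta>' tr' f'" and r: "r \<in> lin_hom K P V"
  shows "shear V r \<in> lin_hom K E (crossed_product P V (la', ra', \<theta>', tr', f'))"
proof -
  interpret C': crossed_datum K P V la' ra' \<theta>' tr' f' by fact
  note [simp] = lin_hom_rules[OF modules r]
  show ?thesis by (rule lin_homI) (auto simp: V.a_ac V.smult_r_distr)
qed

lemma shear_bij:
  assumes "r \<in> lin_hom K P V"
  shows "bij_betw (shear V r) (carrier E) (carrier P \<times> carrier V)"
proof (rule bij_betw_byWitness[where f' = "shear V (\<lambda>p. \<ominus>\<^bsub>V\<^esub> r p)"])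
qed (use lin_hom_rules[OF modules assms] in \<open>auto simp: V.a_assoc[symmetric] V.l_neg V.r_neg\<close>)

text \<open>
  The five coboundary relations are the homomorphism conditions of the shear, evaluated on
  homogeneous pairs: \<open>P \<times> V\<close> and \<open>V \<times> P\<close> give the relations for the three actions, and
  \<open>P \<times> P\<close> those for the two cocycles.
\<close>

lemma shear_hom_iff:
  assumes C': "crossed_datum K P V la' ra' \<theta>' tr' f'" and r: "r \<in> lin_hom K P V"
  shows "shear V r \<in> poisson_hom K E (crossed_product P V (la', ra', \<theta>', tr', f')) \<longleftrightarrow>
    cohomologous_via P V r datum (la', ra', \<theta>', tr', f')"
proof -
  interpret C': crossed_datum K P V la' ra' \<theta>' tr' f' by fact
  note [simp] = lin_hom_rules[OF modules r]
  note lin = shear_lin_hom[OF C' r]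
  \<comment> \<open>Oriented to remove a minus sign; as a plain swap of arguments it would rewrite forever.\<close>
  have skew: "\<ominus>\<^bsub>V\<^esub> \<lbrace>r p, x\<rbrace>\<^bsub>V\<^esub> = \<lbrace>x, r p\<rbrace>\<^bsub>V\<^esub>" if "p \<in> carrier P" "x \<in> carrier V" for p x
    by (rule V.minus_equality) (use that in \<open>simp_all add: V.bracket_skew\<close>)
  show ?thesis
  proof
    assume hom: "shear V r \<in> poisson_hom K E C'.E"
    have m: "shear V r (u \<otimes>\<^bsub>E\<^esub> v) = shear V r u \<otimes>\<^bsub>C'.E\<^esub> shear V r v"
      and b: "shear V r \<lbrace>u, v\<rbrace>\<^bsub>E\<^esub> = \<lbrace>shear V r u, shear V r v\<rbrace>\<^bsub>C'.E\<^esub>"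
      if "u \<in> carrier E" "v \<in> carrier E" for u v
      using hom that unfolding poisson_hom_def by blast+
    show "cohomologous_via P V r datum C'.datum"
      unfolding cohomologous_via_def prod.case
    proof (intro ballI conjI)
      fix p q x assume a: "p \<in> carrier P" "q \<in> carrier P" "x \<in> carrier V"
      let ?p = "(p, \<zero>\<^bsub>V\<^esub>)" and ?q = "(q, \<zero>\<^bsub>V\<^esub>)" and ?x = "(\<zero>\<^bsub>P\<^esub>, x)"
      show "la p x = la' p x \<oplus>\<^bsub>V\<^esub> r p \<otimes>\<^bsub>V\<^esub> x" using m[of ?p ?x] a by simp
      show "ra x p = ra' x p \<oplus>\<^bsub>V\<^esub> x \<otimes>\<^bsub>V\<^esub> r p" using m[of ?x ?p] a by simp
      show "\<theta> p q = \<theta>' p q \<oplus>\<^bsub>V\<^esub> la' p (r q) \<oplus>\<^bsub>V\<^esub> ra' (r p) q \<ominus>\<^bsub>V\<^esub> r (p \<otimes>\<^bsub>P\<^esub> q) \<oplus>\<^bsub>V\<^esub> r p \<otimes>\<^bsub>V\<^esub> r q"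
        using m[of ?p ?q] a by (simp add: eq_diff_sum_iff)
      show "tr p x = tr' p x \<oplus>\<^bsub>V\<^esub> \<lbrace>r p, x\<rbrace>\<^bsub>V\<^esub>" using b[of ?p ?x] a by (simp add: V.minus_eq)
      show "f p q = f' p q \<oplus>\<^bsub>V\<^esub> tr' p (r q) \<ominus>\<^bsub>V\<^esub> tr' q (r p) \<oplus>\<^bsub>V\<^esub> \<lbrace>r p, r q\<rbrace>\<^bsub>V\<^esub> \<ominus>\<^bsub>V\<^esub> r \<lbrace>p, q\<rbrace>\<^bsub>P\<^esub>"
        using b[of ?p ?q] a by (subst eq_diff_iff) (simp_all add: V.minus_eq)
    qed
  next
    assume rel: "cohomologous_via P V r datum C'.datum"
    have r1: "la p x = la' p x \<oplus>\<^bsub>V\<^esub> r p \<otimes>\<^bsub>V\<^esub> x" "ra x p = ra' x p \<oplus>\<^bsub>V\<^esub> x \<otimes>\<^bsub>V\<^esub> r p"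
      "tr p x = tr' p x \<oplus>\<^bsub>V\<^esub> \<lbrace>r p, x\<rbrace>\<^bsub>V\<^esub>"
      if "p \<in> carrier P" "x \<in> carrier V" for p x
      using rel that unfolding cohomologous_via_def prod.case by blast+
    have r2: "r (p \<otimes>\<^bsub>P\<^esub> q) \<oplus>\<^bsub>V\<^esub> \<theta> p q = \<theta>' p q \<oplus>\<^bsub>V\<^esub> la' p (r q) \<oplus>\<^bsub>V\<^esub> ra' (r p) q \<oplus>\<^bsub>V\<^esub> r p \<otimes>\<^bsub>V\<^esub> r q"
      "r \<lbrace>p, q\<rbrace>\<^bsub>P\<^esub> \<oplus>\<^bsub>V\<^esub> f p q = f' p q \<oplus>\<^bsub>V\<^esub> tr' p (r q) \<ominus>\<^bsub>V\<^esub> tr' q (r p) \<oplus>\<^bsub>V\<^esub> \<lbrace>r p, r q\<rbrace>\<^bsub>V\<^esub>"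
      if "p \<in> carrier P" "q \<in> carrier P" for p q
    proof -
      have "\<theta> p q = \<theta>' p q \<oplus>\<^bsub>V\<^esub> la' p (r q) \<oplus>\<^bsub>V\<^esub> ra' (r p) q \<ominus>\<^bsub>V\<^esub> r (p \<otimes>\<^bsub>P\<^esub> q) \<oplus>\<^bsub>V\<^esub> r p \<otimes>\<^bsub>V\<^esub> r q"
        "f p q = f' p q \<oplus>\<^bsub>V\<^esub> tr' p (r q) \<ominus>\<^bsub>V\<^esub> tr' q (r p) \<oplus>\<^bsub>V\<^esub> \<lbrace>r p, r q\<rbrace>\<^bsub>V\<^esub> \<ominus>\<^bsub>V\<^esub> r \<lbrace>p, q\<rbrace>\<^bsub>P\<^esub>"
        using rel that V.zero_closed unfolding cohomologous_via_def prod.case by blast+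
      note * = this
      show "r (p \<otimes>\<^bsub>P\<^esub> q) \<oplus>\<^bsub>V\<^esub> \<theta> p q = \<theta>' p q \<oplus>\<^bsub>V\<^esub> la' p (r q) \<oplus>\<^bsub>V\<^esub> ra' (r p) q \<oplus>\<^bsub>V\<^esub> r p \<otimes>\<^bsub>V\<^esub> r q"
        by (rule iffD1[OF eq_diff_sum_iff *(1)]) (simp_all add: that)
      show "r \<lbrace>p, q\<rbrace>\<^bsub>P\<^esub> \<oplus>\<^bsub>V\<^esub> f p q = f' p q \<oplus>\<^bsub>V\<^esub> tr' p (r q) \<ominus>\<^bsub>V\<^esub> tr' q (r p) \<oplus>\<^bsub>V\<^esub> \<lbrace>r p, r q\<rbrace>\<^bsub>V\<^esub>"
        by (rule iffD1[OF eq_diff_iff *(2)]) (simp_all add: that)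
    qed
    have m: "shear V r (u \<otimes>\<^bsub>E\<^esub> v) = shear V r u \<otimes>\<^bsub>C'.E\<^esub> shear V r v"
      if "u \<in> carrier E" "v \<in> carrier E" for u v
    proof (rule bilinear_eqI[OF module_crossed_product C'.module_crossed_product
          lin_hom_compose_bilinear[OF bilinear_crossed_product(1) lin]
          bilinear_compose[OF C'.bilinear_crossed_product(1) lin lin]
          sum_decomposes_homogeneous _ that])
      show "shear V r (u \<otimes>\<^bsub>E\<^esub> v) = shear V r u \<otimes>\<^bsub>C'.E\<^esub> shear V r v"
        if "u \<in> homogeneous" "v \<in> homogeneous" for u v
        using that unfolding homogeneous_def
        by (elim UnE imageE) (simp_all add: r1 r2)
    qed
    have b: "shear V r \<lbrace>u, v\<rbrace>\<^bsub>E\<^esub> = \<lbrace>shear V r u, shear V r v\<rbrace>\<^bsub>C'.E\<^esub>"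
      if "u \<in> carrier E" "v \<in> carrier E" for u v
    proof (rule bilinear_eqI[OF module_crossed_product C'.module_crossed_product
          lin_hom_compose_bilinear[OF bilinear_crossed_product(2) lin]
          bilinear_compose[OF C'.bilinear_crossed_product(2) lin lin]
          sum_decomposes_homogeneous _ that])
      show "shear V r \<lbrace>u, v\<rbrace>\<^bsub>E\<^esub> = \<lbrace>shear V r u, shear V r v\<rbrace>\<^bsub>C'.E\<^esub>"
        if "u \<in> homogeneous" "v \<in> homogeneous" for u v
        using that unfolding homogeneous_def
        by (elim UnE imageE) (simp_all add: r1 r2 V.minus_eq V.minus_add skew)
    qed
    show "shear V r \<in> poisson_hom K E C'.E"
      using lin m b by (auto simp: poisson_hom_def simp del: crossed_product_sel C'.crossed_product_sel)
  qed
qed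

end

section \<open>Equivalence of extensions\<close>

lemma extensions_iff:
  "(E, i, p) \<in> extensions K P V \<longleftrightarrow>
     poisson_algebra K E \<and> i \<in> poisson_hom K V E \<and> p \<in> poisson_hom K E P \<and>
     inj_on i (carrier V) \<and> i ` carrier V = a_kernel E P p \<and> p ` carrier E = carrier P"
  by (simp add: extensions_def)

lemma poisson_hom_closed: "\<lbrakk>h \<in> poisson_hom K A B; x \<in> carrier A\<rbrakk> \<Longrightarrow> h x \<in> carrier B"
  by (auto simp: poisson_hom_def lin_hom_def)

lemma poisson_hom_compose:
  "\<lbrakk>g \<in> poisson_hom K A B; h \<in> poisson_hom K B C\<rbrakk> \<Longrightarrow> (\<lambda>x. h (g x)) \<in> poisson_hom K A C"
  by (auto simp: poisson_hom_def lin_hom_def Pi_iff)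

lemma poisson_hom_inverse:
  assumes "poisson_algebra K A" and h: "h \<in> poisson_hom K A B" "bij_betw h (carrier A) (carrier B)"
  shows "inv_into (carrier A) h \<in> poisson_hom K B A"
proof -
  interpret A: poisson_algebra K A by fact
  note A = A.module_axioms
  note [simp] = bilinear_rules(1)[OF A A A A.mult_bilinear] bilinear_rules(1)[OF A A A A.bracket_bilinear]
  let ?g = "inv_into (carrier A) h"
  have g [simp]: "?g y \<in> carrier A" "h (?g y) = y" if "y \<in> carrier B" for y
    using h(2) that by (auto simp: bij_betw_def inv_into_into f_inv_into_f)
  have *: "?g y = x" if "x \<in> carrier A" "y = h x" for x y
    using h(2) that by (simp add: bij_betw_def)
  show ?thesis
    unfolding poisson_hom_def lin_hom_def
    using h(1) by (auto simp: poisson_hom_def lin_hom_def intro!: *)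
qed

lemma ext_equiv_refl:
  fixes K :: "('k, 'm) ring_scheme" and X :: "('k, 'p, 'v, 'e) ext_data"
  assumes "X \<in> extensions K P V"
  shows "(X, X) \<in> ext_equiv K P V"
proof -
  have "(\<lambda>x. x) \<in> poisson_hom K E E" for E :: "('k, 'e) poisson"
    by (auto simp: poisson_hom_def lin_hom_def)
  moreover have "bij_betw (\<lambda>x. x) A A" for A :: "'e set" by (simp add: bij_betw_def)
  ultimately show ?thesis using assms
    by (cases X) (auto simp: ext_equiv_def intro!: bexI[of _ "\<lambda>x. x"])
qed

lemma ext_equiv_sym:
  assumes "(X, Y) \<in> ext_equiv K P V"
  shows "(Y, X) \<in> ext_equiv K P V"
proof -
  obtain E i p E' i' p' \<phi> where X: "X = (E, i, p)" "Y = (E', i', p')"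
    and ext: "X \<in> extensions K P V" "Y \<in> extensions K P V"
    and \<phi>: "\<phi> \<in> poisson_hom K E E'" "bij_betw \<phi> (carrier E) (carrier E')"
      "\<forall>x\<in>carrier V. \<phi> (i x) = i' x" "\<forall>e\<in>carrier E. p' (\<phi> e) = p e"
    using assms by (auto simp: ext_equiv_def)
  let ?\<psi> = "inv_into (carrier E) \<phi>"
  have "?\<psi> \<in> poisson_hom K E' E" using ext X \<phi> by (intro poisson_hom_inverse) (auto simp: extensions_iff)
  moreover have "bij_betw ?\<psi> (carrier E') (carrier E)" using \<phi> by (intro bij_betw_inv_into)
  moreover have "?\<psi> (i' x) = i x" if "x \<in> carrier V" for x
  proof -
    have "i x \<in> carrier E" using ext X that by (auto simp: extensions_iff dest: poisson_hom_closed)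
    then show ?thesis using \<phi> that by (metis bij_betw_inv_into_left)
  qed
  moreover have "p (?\<psi> e) = p' e" if "e \<in> carrier E'" for e
    using \<phi> that by (metis bij_betw_inv_into_right bij_betwE calculation(2))
  ultimately show ?thesis using X ext by (auto simp: ext_equiv_def)
qed

lemma ext_equiv_trans:
  assumes "(X, Y) \<in> ext_equiv K P V" "(Y, Z) \<in> ext_equiv K P V"
  shows "(X, Z) \<in> ext_equiv K P V"
proof -
  obtain E i p E' i' p' E'' i'' p'' \<phi> \<psi>
    where X: "X = (E, i, p)" "Y = (E', i', p')" "Z = (E'', i'', p'')"
    and ext: "X \<in> extensions K P V" "Z \<in> extensions K P V"
    and \<phi>: "\<phi> \<in> poisson_hom K E E'" "bij_betw \<phi> (carrier E) (carrier E')"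
      "\<forall>x\<in>carrier V. \<phi> (i x) = i' x" "\<forall>e\<in>carrier E. p' (\<phi> e) = p e"
    and \<psi>: "\<psi> \<in> poisson_hom K E' E''" "bij_betw \<psi> (carrier E') (carrier E'')"
      "\<forall>x\<in>carrier V. \<psi> (i' x) = i'' x" "\<forall>e\<in>carrier E'. p'' (\<psi> e) = p' e"
    using assms by (auto simp: ext_equiv_def)
  have "bij_betw (\<lambda>e. \<psi> (\<phi> e)) (carrier E) (carrier E'')"
    using bij_betw_trans[OF \<phi>(2) \<psi>(2)] by (simp add: o_def)
  then show ?thesis
    using X ext \<phi>(3,4) \<psi>(3,4) poisson_hom_closed[OF \<phi>(1)] poisson_hom_compose[OF \<phi>(1) \<psi>(1)]
    by (auto simp: ext_equiv_def intro!: bexI[of _ "\<lambda>e. \<psi> (\<phi> e)"])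
qed

lemma equiv_ext_equiv: "equiv (extensions K P V) (ext_equiv K P V)"
proof (rule equivI)
  show "ext_equiv K P V \<subseteq> extensions K P V \<times> extensions K P V" by (auto simp: ext_equiv_def)
qed (auto simp: refl_on_def sym_def trans_def intro: ext_equiv_refl ext_equiv_sym ext_equiv_trans)

lemma LPS_iff: "(la, ra, \<theta>, tr, f) \<in> LPS K P V \<longleftrightarrow> local_crossed_system K P V la ra \<theta> tr f"
  by (simp add: LPS_def)

lemma crossed_product_ext_in_extensions:
  assumes "c \<in> LPS K P V"
  shows "crossed_product_ext P V c \<in> extensions K P V"
proof -
  obtain la ra \<theta> tr f where c: "c = (la, ra, \<theta>, tr, f)" by (cases c) auto
  interpret local_crossed_system K P V la ra \<theta> tr f using assms by (simp add: c LPS_iff)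
  have "(\<lambda>x. (\<zero>\<^bsub>P\<^esub>, x)) \<in> poisson_hom K V E"
    by (auto simp: poisson_hom_def lin_hom_def V.minus_eq)
  moreover have "fst \<in> poisson_hom K E P" by (auto simp: poisson_hom_def lin_hom_def)
  moreover have "fst ` carrier E = carrier P" by force
  ultimately show ?thesis
    by (auto simp: c crossed_product_ext_def extensions_iff poisson_algebra_crossed_product
        inj_on_def a_kernel_def')
qed

text \<open>
  An equivalence \<open>\<phi>\<close> of crossed product extensions is the shear by \<open>r p = snd (\<phi> (p, 0))\<close>, because
  \<open>(p, x) = (p, 0) + (0, x)\<close>.
\<close>

theorem local_cohom_iff_ext_equiv:
  assumes c: "c \<in> LPS K P V" and c': "c' \<in> LPS K P V"
  shows "(c, c') \<in> local_cohom K P V \<longleftrightarrow>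
    (crossed_product_ext P V c, crossed_product_ext P V c') \<in> ext_equiv K P V"
proof -
  obtain la ra \<theta> tr f where cc: "c = (la, ra, \<theta>, tr, f)" by (cases c) auto
  obtain la' ra' \<theta>' tr' f' where cc': "c' = (la', ra', \<theta>', tr', f')" by (cases c') auto
  interpret C: local_crossed_system K P V la ra \<theta> tr f using c by (simp add: cc LPS_iff)
  interpret C': local_crossed_system K P V la' ra' \<theta>' tr' f' using c' by (simp add: cc' LPS_iff)
  have iff: "(crossed_product_ext P V c, crossed_product_ext P V c') \<in> ext_equiv K P V \<longleftrightarrow>
    (\<exists>\<phi>\<in>poisson_hom K C.E C'.E. bij_betw \<phi> (carrier P \<times> carrier V) (carrier P \<times> carrier V) \<and>
      (\<forall>x\<in>carrier V. \<phi> (\<zero>\<^bsub>P\<^esub>, x) = (\<zero>\<^bsub>P\<^esub>, x)) \<and> (\<forall>p\<in>carrier P. \<forall>x\<in>carrier V. fst (\<phi> (p, x)) = p))"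
    using crossed_product_ext_in_extensions[OF c] crossed_product_ext_in_extensions[OF c']
    by (auto simp: ext_equiv_def crossed_product_ext_def cc cc')
  show ?thesis
  proof
    assume "(c, c') \<in> local_cohom K P V"
    then obtain r where r: "r \<in> lin_hom K P V" "cohomologous_via P V r c c'"
      by (auto simp: local_cohom_iff)
    then have "shear V r \<in> poisson_hom K C.E C'.E"
      using C.shear_hom_iff[OF C'.crossed_datum_axioms] by (simp add: cc cc')
    then show "(crossed_product_ext P V c, crossed_product_ext P V c') \<in> ext_equiv K P V"
      using C.shear_bij[OF r(1)] lin_hom_rules(4)[OF C.modules r(1)] unfolding iff
      by (intro bexI[of _ "shear V r"]) auto
  next
    assume "(crossed_product_ext P V c, crossed_product_ext P V c') \<in> ext_equiv K P V"
    then obtain \<phi> where \<phi>: "\<phi> \<in> poisson_hom K C.E C'.E"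
      "\<And>x. x \<in> carrier V \<Longrightarrow> \<phi> (\<zero>\<^bsub>P\<^esub>, x) = (\<zero>\<^bsub>P\<^esub>, x)"
      "\<And>p x. \<lbrakk>p \<in> carrier P; x \<in> carrier V\<rbrakk> \<Longrightarrow> fst (\<phi> (p, x)) = p"
      unfolding iff by blast
    have lin: "\<phi> \<in> lin_hom K C.E C'.E" using \<phi>(1) by (simp add: poisson_hom_def)
    note L = lin_hom_rules[OF C.module_crossed_product C'.module_crossed_product lin]
    define r where "r p = snd (\<phi> (p, \<zero>\<^bsub>V\<^esub>))" for p
    have \<phi>0: "\<phi> (p, \<zero>\<^bsub>V\<^esub>) = (p, r p)" if "p \<in> carrier P" for p
      using \<phi>(3)[OF that, of "\<zero>\<^bsub>V\<^esub>"] by (simp add: r_def prod_eq_iff)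
    have rcl: "r p \<in> carrier V" if "p \<in> carrier P" for p
      using L(1)[of "(p, \<zero>\<^bsub>V\<^esub>)"] that by (simp add: \<phi>0)
    have r: "r \<in> lin_hom K P V"
    proof (rule lin_homI)
      show "r (p \<oplus>\<^bsub>P\<^esub> q) = r p \<oplus>\<^bsub>V\<^esub> r q" if "p \<in> carrier P" "q \<in> carrier P" for p q
        using L(2)[of "(p, \<zero>\<^bsub>V\<^esub>)" "(q, \<zero>\<^bsub>V\<^esub>)"] that by (simp add: \<phi>0)
      show "r (a \<odot>\<^bsub>P\<^esub> p) = a \<odot>\<^bsub>V\<^esub> r p" if "a \<in> carrier K" "p \<in> carrier P" for a p
        using L(3)[of a "(p, \<zero>\<^bsub>V\<^esub>)"] that by (simp add: \<phi>0)
    qed (rule rcl)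
    have eq: "\<phi> u = shear V r u" if u_in: "u \<in> carrier C.E" for u
    proof -
      obtain p x where u: "u = (p, x)" "p \<in> carrier P" "x \<in> carrier V" using u_in by auto
      then have "\<phi> u = \<phi> ((p, \<zero>\<^bsub>V\<^esub>) \<oplus>\<^bsub>C.E\<^esub> (\<zero>\<^bsub>P\<^esub>, x))" by simp
      also have "\<dots> = shear V r u"
        using u by (subst L(2)) (simp_all add: \<phi>0 \<phi>(2) rcl)
      finally show ?thesis .
    qed
    have "shear V r \<in> poisson_hom K C.E C'.E"
      using C.shear_lin_hom[OF C'.crossed_datum_axioms r] \<phi>(1) eq
        bilinear_rules(1)[OF C.module_crossed_product C.module_crossed_product C.module_crossed_product
          C.bilinear_crossed_product(1)]
        bilinear_rules(1)[OF C.module_crossed_product C.module_crossed_product C.module_crossed_product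
          C.bilinear_crossed_product(2)]
      by (simp add: poisson_hom_def eq del: C.crossed_product_sel C'.crossed_product_sel)
    then have "cohomologous_via P V r c c'"
      using C.shear_hom_iff[OF C'.crossed_datum_axioms r] by (simp add: cc cc')
    then show "(c, c') \<in> local_cohom K P V" using c c' r by (auto simp: local_cohom_iff)
  qed
qed

section \<open>Every extension is a crossed product\<close>

text \<open>
  Without a bound on the dimension the section comes from Zorn's lemma, applied to the subspaces of
  \<open>E\<close> that meet the kernel of \<open>h\<close> trivially.  On a maximal such subspace \<open>M\<close> the map \<open>h\<close> is injective; it is also
  onto \<open>P\<close>, and the section is the inverse of the restriction.
\<close>

lemma linear_section_exists:
  assumes "field K" and E: "module K E" and P: "module K P"
    and h: "h \<in> lin_hom K E P" and surj: "h ` carrier E = carrier P"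
  obtains s where "s \<in> lin_hom K P E" "\<And>p. p \<in> carrier P \<Longrightarrow> h (s p) = p"
proof -
  interpret K: field K by fact
  interpret E: module K E by fact
  interpret P: module K P by fact
  note [simp] = lin_hom_rules[OF E P h]
  define \<A> where "\<A> = {S. S \<subseteq> carrier E \<and> \<zero>\<^bsub>E\<^esub> \<in> S \<and>
    (\<forall>x\<in>S. \<forall>y\<in>S. x \<oplus>\<^bsub>E\<^esub> y \<in> S) \<and> (\<forall>c\<in>carrier K. \<forall>x\<in>S. c \<odot>\<^bsub>E\<^esub> x \<in> S) \<and>
    (\<forall>x\<in>S. h x = \<zero>\<^bsub>P\<^esub> \<longrightarrow> x = \<zero>\<^bsub>E\<^esub>)}"
  have "\<exists>M\<in>\<A>. \<forall>X\<in>\<A>. M \<subseteq> X \<longrightarrow> X = M"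
  proof (rule subset_Zorn_nonempty)
    have "{\<zero>\<^bsub>E\<^esub>} \<in> \<A>" by (simp add: \<A>_def)
    then show "\<A> \<noteq> {}" by blast
  next
    fix \<C> assume ne: "\<C> \<noteq> {}" and chain: "subset.chain \<A> \<C>"
    have sub: "S \<in> \<A>" if "S \<in> \<C>" for S using chain that by (auto simp: subset_chain_def)
    have mem: "x \<in> carrier E" "h x = \<zero>\<^bsub>P\<^esub> \<Longrightarrow> x = \<zero>\<^bsub>E\<^esub>"
      "c \<in> carrier K \<Longrightarrow> c \<odot>\<^bsub>E\<^esub> x \<in> \<Union>\<C>" if "S \<in> \<C>" "x \<in> S" for S x c
      using sub[OF that(1)] that unfolding \<A>_def by blast+
    have common: "\<exists>S\<in>\<C>. x \<in> S \<and> y \<in> S" if xy: "x \<in> \<Union>\<C>" "y \<in> \<Union>\<C>" for x y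
    proof -
      obtain S T where "S \<in> \<C>" "T \<in> \<C>" "x \<in> S" "y \<in> T" using xy by blast
      moreover from this have "S \<subseteq> T \<or> T \<subseteq> S" using chain by (simp add: subset_chain_def)
      ultimately show ?thesis by blast
    qed
    have "x \<oplus>\<^bsub>E\<^esub> y \<in> \<Union>\<C>" if xy: "x \<in> \<Union>\<C>" "y \<in> \<Union>\<C>" for x y
    proof -
      obtain S where "S \<in> \<C>" "x \<in> S" "y \<in> S" using common[OF xy] by blast
      then show ?thesis using sub[of S] by (auto simp: \<A>_def)
    qed
    moreover have "\<zero>\<^bsub>E\<^esub> \<in> \<Union>\<C>" using ne sub by (auto simp: \<A>_def)
    ultimately show "\<Union>\<C> \<in> \<A>"
      unfolding \<A>_def by (intro CollectI conjI ballI impI subsetI) (blast intro: mem)+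
  qed
  then obtain M where M: "M \<in> \<A>" and max: "\<And>X. \<lbrakk>X \<in> \<A>; M \<subseteq> X\<rbrakk> \<Longrightarrow> X = M" by blast
  have sub: "\<And>x. x \<in> M \<Longrightarrow> x \<in> carrier E" and zero: "\<zero>\<^bsub>E\<^esub> \<in> M"
    and add: "\<And>x y. \<lbrakk>x \<in> M; y \<in> M\<rbrakk> \<Longrightarrow> x \<oplus>\<^bsub>E\<^esub> y \<in> M"
    and smult: "\<And>c x. \<lbrakk>c \<in> carrier K; x \<in> M\<rbrakk> \<Longrightarrow> c \<odot>\<^bsub>E\<^esub> x \<in> M"
    and ker: "\<And>x. \<lbrakk>x \<in> M; h x = \<zero>\<^bsub>P\<^esub>\<rbrakk> \<Longrightarrow> x = \<zero>\<^bsub>E\<^esub>"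
    using M unfolding \<A>_def by blast+
  have neg: "\<ominus>\<^bsub>E\<^esub> x \<in> M" if "x \<in> M" for x
    using smult[of "\<ominus>\<^bsub>K\<^esub> \<one>\<^bsub>K\<^esub>" x] that sub E.smult_l_minus[of "\<one>\<^bsub>K\<^esub>" x] by simp
  have inj: "x = y" if "x \<in> M" "y \<in> M" "h x = h y" for x y
  proof -
    have "x \<oplus>\<^bsub>E\<^esub> \<ominus>\<^bsub>E\<^esub> y = \<zero>\<^bsub>E\<^esub>" using that sub by (intro ker add neg) (simp_all add: P.r_neg)
    then show ?thesis using that sub by (metis E.a_inv_closed E.minus_equality E.minus_minus)
  qed
  have "p \<in> h ` M" if p: "p \<in> carrier P" for p
  proof (rule ccontr)
    assume np: "p \<notin> h ` M"
    have "p \<in> h ` carrier E" using surj p by simp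
    then obtain e where e: "e \<in> carrier E" "h e = p" by auto
    \<comment> \<open>If \<open>p\<close> were missed, \<open>M + K e\<close> would be a larger admissible subspace: a kernel element
      \<open>g + c e\<close> with \<open>c \<noteq> 0\<close> would give \<open>p = h (- g / c)\<close>.\<close>
    define M' where "M' = {g \<oplus>\<^bsub>E\<^esub> c \<odot>\<^bsub>E\<^esub> e |g c. g \<in> M \<and> c \<in> carrier K}"
    have M'I: "g \<oplus>\<^bsub>E\<^esub> c \<odot>\<^bsub>E\<^esub> e \<in> M'" if "g \<in> M" "c \<in> carrier K" for g c
      using that by (auto simp: M'_def)
    have sub': "M \<subseteq> M'"
    proof
      fix x assume "x \<in> M"
      then show "x \<in> M'" using M'I[of x "\<zero>\<^bsub>K\<^esub>"] e sub by simp
    qed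
    have "M' \<in> \<A>"
      unfolding \<A>_def
    proof (intro CollectI conjI ballI impI)
      show "M' \<subseteq> carrier E" using e sub by (auto simp: M'_def)
      show "\<zero>\<^bsub>E\<^esub> \<in> M'" using sub' zero by blast
    next
      fix x y assume "x \<in> M'" "y \<in> M'"
      then obtain g c g' c' where *: "x = g \<oplus>\<^bsub>E\<^esub> c \<odot>\<^bsub>E\<^esub> e" "g \<in> M" "c \<in> carrier K"
        "y = g' \<oplus>\<^bsub>E\<^esub> c' \<odot>\<^bsub>E\<^esub> e" "g' \<in> M" "c' \<in> carrier K" unfolding M'_def by blast
      then have "x \<oplus>\<^bsub>E\<^esub> y = (g \<oplus>\<^bsub>E\<^esub> g') \<oplus>\<^bsub>E\<^esub> (c \<oplus>\<^bsub>K\<^esub> c') \<odot>\<^bsub>E\<^esub> e"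
        using e sub by (simp add: E.smult_l_distr E.a_ac)
      then show "x \<oplus>\<^bsub>E\<^esub> y \<in> M'" using * by (simp add: M'I add)
    next
      fix d x assume d: "d \<in> carrier K" and "x \<in> M'"
      then obtain g c where *: "x = g \<oplus>\<^bsub>E\<^esub> c \<odot>\<^bsub>E\<^esub> e" "g \<in> M" "c \<in> carrier K" unfolding M'_def by blast
      then have "d \<odot>\<^bsub>E\<^esub> x = (d \<odot>\<^bsub>E\<^esub> g) \<oplus>\<^bsub>E\<^esub> (d \<otimes>\<^bsub>K\<^esub> c) \<odot>\<^bsub>E\<^esub> e"
        using e d sub by (simp add: E.smult_r_distr E.smult_assoc1)
      then show "d \<odot>\<^bsub>E\<^esub> x \<in> M'" using * d by (simp add: M'I smult)
    next
      fix x assume "x \<in> M'" and x0: "h x = \<zero>\<^bsub>P\<^esub>"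
      then obtain g c where *: "x = g \<oplus>\<^bsub>E\<^esub> c \<odot>\<^bsub>E\<^esub> e" "g \<in> M" "c \<in> carrier K" unfolding M'_def by blast
      have "c = \<zero>\<^bsub>K\<^esub>"
      proof (rule ccontr)
        assume "c \<noteq> \<zero>\<^bsub>K\<^esub>"
        then have c: "inv\<^bsub>K\<^esub> c \<in> carrier K" "inv\<^bsub>K\<^esub> c \<otimes>\<^bsub>K\<^esub> c = \<one>\<^bsub>K\<^esub>"
          using *(3) K.field_Units by (auto intro: K.Units_inv_closed K.Units_l_inv)
        have "h (inv\<^bsub>K\<^esub> c \<odot>\<^bsub>E\<^esub> (\<ominus>\<^bsub>E\<^esub> g)) = p"
        proof -
          have "h g \<oplus>\<^bsub>P\<^esub> c \<odot>\<^bsub>P\<^esub> p = \<zero>\<^bsub>P\<^esub>" using x0 * e sub by simp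
          then have "\<ominus>\<^bsub>P\<^esub> h g = c \<odot>\<^bsub>P\<^esub> p"
            using * sub p by (metis E.M.zero_closed P.M.a_comm P.minus_equality P.smult_closed lin_hom_rules(1)[OF E P h])
          then show ?thesis using c * sub p by (simp add: P.smult_assoc1[symmetric])
        qed
        then show False using np * c smult neg by (metis imageI)
      qed
      then show "x = \<zero>\<^bsub>E\<^esub>" using * x0 e sub ker by simp
    qed
    then have "M' = M" using max sub' by blast
    moreover have "e \<in> M'" using M'I[OF zero, of "\<one>\<^bsub>K\<^esub>"] e by simp
    ultimately show False using np e by blast
  qed
  then have img: "inv_into M h p \<in> M" "h (inv_into M h p) = p" if "p \<in> carrier P" for p
    using that by (auto simp: inv_into_into f_inv_into_f)
  show thesis
  proof (rule that)
    show "inv_into M h \<in> lin_hom K P E"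
    proof (rule lin_homI)
      show "inv_into M h p \<in> carrier E" if "p \<in> carrier P" for p using img that sub by blast
      show "inv_into M h (p \<oplus>\<^bsub>P\<^esub> q) = inv_into M h p \<oplus>\<^bsub>E\<^esub> inv_into M h q"
        if "p \<in> carrier P" "q \<in> carrier P" for p q
        using that by (intro inj) (simp_all add: img add sub)
      show "inv_into M h (c \<odot>\<^bsub>P\<^esub> p) = c \<odot>\<^bsub>E\<^esub> inv_into M h p"
        if "c \<in> carrier K" "p \<in> carrier P" for c p
        using that by (intro inj) (simp_all add: img smult sub)
    qed
  qed (rule img)
qed

text \<open>
  The structure maps of the crossed system are products and brackets in \<open>E\<close> that happen to lie in the
  kernel; this pulls them back to \<open>V\<close>.  Restriction to the carriers makes the result extensional.
\<close>

lemma bilinear_map_into_kernel: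
  assumes A: "module K A" and B: "module K B" and V: "module K V" and E: "module K E"
    and i: "i \<in> lin_hom K V E" and inj: "inj_on i (carrier V)"
    and g: "bilinear K A B E g"
    and img: "\<And>a b. \<lbrakk>a \<in> carrier A; b \<in> carrier B\<rbrakk> \<Longrightarrow> g a b \<in> i ` carrier V"
  obtains h where "h \<in> bilinear_maps K A B V"
    and "\<And>a b. \<lbrakk>a \<in> carrier A; b \<in> carrier B\<rbrakk> \<Longrightarrow> i (h a b) = g a b"
proof -
  define h where "h = (\<lambda>a\<in>carrier A. \<lambda>b\<in>carrier B. inv_into (carrier V) i (g a b))"
  interpret A: module K A by fact
  interpret B: module K B by fact
  interpret V: module K V by fact
  have h: "h a b \<in> carrier V" "i (h a b) = g a b" if "a \<in> carrier A" "b \<in> carrier B" for a b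
    using img[OF that] that by (simp_all add: h_def inv_into_into f_inv_into_f)
  note [simp] = bilinear_rules[OF A B E g] lin_hom_rules[OF V E i] h
  have eq: "x = y" if "x \<in> carrier V" "y \<in> carrier V" "i x = i y" for x y
    using inj that by (auto dest: inj_onD)
  have "bilinear K A B V h"
    unfolding bilinear_def by (intro conjI ballI lin_homI; (rule eq)?; simp)
  then have "h \<in> bilinear_maps K A B V"
    using h(1) by (auto simp: bilinear_maps_def h_def)
  then show thesis using h(2) by (rule that)
qed

text \<open>
  A linear section \<open>s\<close> identifies \<open>E\<close> with \<open>P \<times> V\<close> by \<open>\<phi> (p, x) = s p + i x\<close>.  The actions of \<open>P\<close> on
  \<open>V\<close> are multiplication by and bracket with \<open>s p\<close>, and \<open>\<theta>\<close> and \<open>f\<close> measure the failure of \<open>s\<close> to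
  preserve product and bracket.  With these maps \<open>\<phi>\<close> preserves all operations, so the crossed
  product inherits the Poisson identities from \<open>E\<close>, and the axioms of a crossed system follow
  from them.
\<close>

theorem extension_equiv_crossed_product:
  assumes VP: "poisson_algebra K V" and PP: "poisson_algebra K P"
    and X: "X \<in> extensions K P V"
  shows "\<exists>c\<in>LPS K P V. (crossed_product_ext P V c, X) \<in> ext_equiv K P V"
proof -
  obtain E i \<pi> where XE: "X = (E, i, \<pi>)" by (cases X) auto
  have ext: "poisson_algebra K E" "i \<in> poisson_hom K V E" "\<pi> \<in> poisson_hom K E P"
    "inj_on i (carrier V)" "i ` carrier V = a_kernel E P \<pi>" "\<pi> ` carrier E = carrier P"
    using X by (auto simp: XE extensions_iff)
  interpret E: poisson_algebra K E by fact
  interpret V: poisson_algebra K V by fact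
  interpret P: poisson_algebra K P by fact
  note E = E.module_axioms and V = V.module_axioms and P = P.module_axioms
  have i: "i \<in> lin_hom K V E" and \<pi>: "\<pi> \<in> lin_hom K E P" using ext by (auto simp: poisson_hom_def)
  obtain s where s: "s \<in> lin_hom K P E" and \<pi>s: "\<And>p. p \<in> carrier P \<Longrightarrow> \<pi> (s p) = p"
    by (rule linear_section_exists[OF E.field_axioms E P \<pi> ext(6)]) blast
  have kernel: "i ` carrier V = {e \<in> carrier E. \<pi> e = \<zero>\<^bsub>P\<^esub>}" using ext(5) by (simp add: a_kernel_def')
  then have \<pi>i: "\<pi> (i x) = \<zero>\<^bsub>P\<^esub>" if "x \<in> carrier V" for x using that by blast
  have hom: "i (x \<otimes>\<^bsub>V\<^esub> y) = i x \<otimes>\<^bsub>E\<^esub> i y" "i \<lbrace>x, y\<rbrace>\<^bsub>V\<^esub> = \<lbrace>i x, i y\<rbrace>\<^bsub>E\<^esub>"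
    if "x \<in> carrier V" "y \<in> carrier V" for x y using ext(2) that by (auto simp: poisson_hom_def)
  have \<pi>hom: "\<pi> (x \<otimes>\<^bsub>E\<^esub> y) = \<pi> x \<otimes>\<^bsub>P\<^esub> \<pi> y" "\<pi> \<lbrace>x, y\<rbrace>\<^bsub>E\<^esub> = \<lbrace>\<pi> x, \<pi> y\<rbrace>\<^bsub>P\<^esub>"
    if "x \<in> carrier E" "y \<in> carrier E" for x y using ext(3) that by (auto simp: poisson_hom_def)
  note mE = E.mult_bilinear and bE = E.bracket_bilinear
  note [simp] = lin_hom_rules[OF V E i] lin_hom_rules[OF E P \<pi>] lin_hom_rules[OF P E s]
    bilinear_rules[OF E E E mE] bilinear_rules[OF E E E bE] \<pi>s \<pi>i hom \<pi>hom
    bilinear_rules[OF P P P P.mult_bilinear] bilinear_rules[OF P P P P.bracket_bilinear]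
  note lift = bilinear_map_into_kernel[OF _ _ V E i ext(4), unfolded kernel]
  obtain la where la: "la \<in> bilinear_maps K P V V"
    "\<And>p x. \<lbrakk>p \<in> carrier P; x \<in> carrier V\<rbrakk> \<Longrightarrow> i (la p x) = s p \<otimes>\<^bsub>E\<^esub> i x"
    by (rule lift[OF P V bilinear_compose[OF mE s i]]) simp_all
  obtain ra where ra: "ra \<in> bilinear_maps K V P V"
    "\<And>p x. \<lbrakk>x \<in> carrier V; p \<in> carrier P\<rbrakk> \<Longrightarrow> i (ra x p) = i x \<otimes>\<^bsub>E\<^esub> s p"
    by (rule lift[OF V P bilinear_compose[OF mE i s]]) simp_all
  obtain tr where tr: "tr \<in> bilinear_maps K P V V"
    "\<And>p x. \<lbrakk>p \<in> carrier P; x \<in> carrier V\<rbrakk> \<Longrightarrow> i (tr p x) = \<lbrace>s p, i x\<rbrace>\<^bsub>E\<^esub>"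
    by (rule lift[OF P V bilinear_compose[OF bE s i]]) simp_all
  obtain \<theta> where \<theta>: "\<theta> \<in> bilinear_maps K P P V"
    "\<And>p q. \<lbrakk>p \<in> carrier P; q \<in> carrier P\<rbrakk> \<Longrightarrow> i (\<theta> p q) = s p \<otimes>\<^bsub>E\<^esub> s q \<ominus>\<^bsub>E\<^esub> s (p \<otimes>\<^bsub>P\<^esub> q)"
    by (rule lift[OF P P bilinear_diff[OF P P E bilinear_compose[OF mE s s]
          lin_hom_compose_bilinear[OF P.mult_bilinear s]]]) (simp_all add: E.minus_eq P.r_neg)
  obtain f where f: "f \<in> bilinear_maps K P P V"
    "\<And>p q. \<lbrakk>p \<in> carrier P; q \<in> carrier P\<rbrakk> \<Longrightarrow> i (f p q) = \<lbrace>s p, s q\<rbrace>\<^bsub>E\<^esub> \<ominus>\<^bsub>E\<^esub> s \<lbrace>p, q\<rbrace>\<^bsub>P\<^esub>"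
    by (rule lift[OF P P bilinear_diff[OF P P E bilinear_compose[OF bE s s]
          lin_hom_compose_bilinear[OF P.bracket_bilinear s]]]) (simp_all add: E.minus_eq P.r_neg)
  interpret C: crossed_datum K P V la ra \<theta> tr f
    by unfold_locales (fact la(1) ra(1) \<theta>(1) tr(1) f(1))+
  define \<phi> where "\<phi> = (\<lambda>(p, x). s p \<oplus>\<^bsub>E\<^esub> i x)"
  have \<phi>_Pair [simp]: "\<phi> (p, x) = s p \<oplus>\<^bsub>E\<^esub> i x" for p x by (simp add: \<phi>_def)
  have lin: "\<phi> \<in> lin_hom K C.E E"
    by (rule lin_homI) (auto simp: E.a_ac E.smult_r_distr)
  have plus_minus: "a \<oplus>\<^bsub>E\<^esub> (b \<ominus>\<^bsub>E\<^esub> a) = b" if "a \<in> carrier E" "b \<in> carrier E" for a b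
    using that by (simp add: E.minus_eq E.a_ac E.r_neg E.a_lcomm[of a b])
  \<comment> \<open>Oriented to remove a minus sign; as a plain swap of arguments it would rewrite forever.\<close>
  have skew: "\<ominus>\<^bsub>E\<^esub> \<lbrace>s p, i x\<rbrace>\<^bsub>E\<^esub> = \<lbrace>i x, s p\<rbrace>\<^bsub>E\<^esub>" if "p \<in> carrier P" "x \<in> carrier V" for p x
    by (rule E.minus_equality) (use that in \<open>simp_all add: E.bracket_skew\<close>)
  note homog = bilinear_eqI[OF C.module_crossed_product E _ _ C.sum_decomposes_homogeneous]
  have m: "\<phi> (u \<otimes>\<^bsub>C.E\<^esub> v) = \<phi> u \<otimes>\<^bsub>E\<^esub> \<phi> v" if "u \<in> carrier C.E" "v \<in> carrier C.E" for u v
  proof (rule homog[OF lin_hom_compose_bilinear[OF C.bilinear_crossed_product(1) lin]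
        bilinear_compose[OF mE lin lin] _ that])
    show "\<phi> (u \<otimes>\<^bsub>C.E\<^esub> v) = \<phi> u \<otimes>\<^bsub>E\<^esub> \<phi> v" if "u \<in> C.homogeneous" "v \<in> C.homogeneous" for u v
      using that unfolding C.homogeneous_def
      by (elim UnE imageE) (simp_all add: la ra \<theta> plus_minus)
  qed
  have b: "\<phi> \<lbrace>u, v\<rbrace>\<^bsub>C.E\<^esub> = \<lbrace>\<phi> u, \<phi> v\<rbrace>\<^bsub>E\<^esub>" if "u \<in> carrier C.E" "v \<in> carrier C.E" for u v
  proof (rule homog[OF lin_hom_compose_bilinear[OF C.bilinear_crossed_product(2) lin]
        bilinear_compose[OF bE lin lin] _ that])
    show "\<phi> \<lbrace>u, v\<rbrace>\<^bsub>C.E\<^esub> = \<lbrace>\<phi> u, \<phi> v\<rbrace>\<^bsub>E\<^esub>" if "u \<in> C.homogeneous" "v \<in> C.homogeneous" for u v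
      using that unfolding C.homogeneous_def
      by (elim UnE imageE) (simp_all add: tr f plus_minus V.minus_eq skew)
  qed
  have hom\<phi>: "\<phi> \<in> poisson_hom K C.E E"
    using lin m b by (simp add: poisson_hom_def del: C.crossed_product_sel)
  have inj: "inj_on \<phi> (carrier C.E)"
  proof (rule inj_onI)
    fix u v assume "u \<in> carrier C.E" "v \<in> carrier C.E" and eq: "\<phi> u = \<phi> v"
    then obtain p x q y where uv: "u = (p, x)" "v = (q, y)"
      and a: "p \<in> carrier P" "x \<in> carrier V" "q \<in> carrier P" "y \<in> carrier V" by auto
    have "\<pi> (\<phi> u) = p" "\<pi> (\<phi> v) = q" using a by (simp_all add: uv)
    then have "p = q" using eq by simp
    moreover from this have "i x = i y" using eq a by (simp add: uv)
    then have "x = y" using ext(4) a by (auto dest: inj_onD)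
    ultimately show "u = v" by (simp add: uv)
  qed
  have "\<phi> ` carrier C.E = carrier E"
  proof
    show "\<phi> ` carrier C.E \<subseteq> carrier E" by auto
    show "carrier E \<subseteq> \<phi> ` carrier C.E"
    proof
      fix e assume e: "e \<in> carrier E"
      then have "e \<ominus>\<^bsub>E\<^esub> s (\<pi> e) \<in> i ` carrier V" by (simp add: kernel E.minus_eq P.r_neg)
      then obtain x where x: "x \<in> carrier V" "e \<ominus>\<^bsub>E\<^esub> s (\<pi> e) = i x" by blast
      have "e = \<phi> (\<pi> e, x)" using e by (simp add: x(2)[symmetric] plus_minus)
      moreover have "(\<pi> e, x) \<in> carrier C.E" using e x by simp
      ultimately show "e \<in> \<phi> ` carrier C.E" by blast
    qed
  qed
  with inj have bij: "bij_betw \<phi> (carrier C.E) (carrier E)" by (simp add: bij_betw_def)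
  have "poisson_algebra K C.E"
    by (rule poisson_algebra_of_injection[OF ext(1) C.module_crossed_product
          C.bilinear_crossed_product hom\<phi> inj])
  then have c: "C.datum \<in> LPS K P V"
    by (simp add: LPS_iff C.local_crossed_system_if_poisson_algebra)
  moreover have "(crossed_product_ext P V C.datum, X) \<in> ext_equiv K P V"
    using crossed_product_ext_in_extensions[OF c] X hom\<phi> bij
    by (auto simp: ext_equiv_def crossed_product_ext_def XE intro!: bexI[of _ \<phi>])
  ultimately show ?thesis by blast
qed

section \<open>Classification of extensions\<close>

text \<open>
  If \<open>R\<close> is the preimage of an equivalence relation \<open>S\<close> under \<open>f\<close>, and \<open>f\<close> meets every class of \<open>S\<close>,
  then \<open>R\<close> inherits the three properties of an equivalence and \<open>f\<close> descends to a bijection.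
\<close>

lemma bij_betw_quotients:
  assumes S: "equiv B S" and f: "\<And>a. a \<in> A \<Longrightarrow> f a \<in> B"
    and R: "R \<subseteq> A \<times> A" "\<And>a a'. \<lbrakk>a \<in> A; a' \<in> A\<rbrakk> \<Longrightarrow> (a, a') \<in> R \<longleftrightarrow> (f a, f a') \<in> S"
    and surj: "\<And>b. b \<in> B \<Longrightarrow> \<exists>a\<in>A. (f a, b) \<in> S"
  shows "equiv A R" and "(\<lambda>a. S `` {f a}) respects R"
    and "bij_betw (\<lambda>C. \<Union>a\<in>C. S `` {f a}) (A // R) (B // S)"
proof -
  have S_refl: "(b, b) \<in> S" if "b \<in> B" for b using S that by (auto simp: equiv_def refl_on_def)
  have S_sym: "(b, a) \<in> S" if "(a, b) \<in> S" for a b using S that by (auto simp: equiv_def sym_def)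
  have S_trans: "(a, c) \<in> S" if "(a, b) \<in> S" "(b, c) \<in> S" for a b c
    using S that unfolding equiv_def trans_def by blast
  have R_dest: "a \<in> A" "b \<in> A" "(f a, f b) \<in> S" if "(a, b) \<in> R" for a b
    using R(1) R(2)[of a b] that by blast+
  show E: "equiv A R"
  proof (rule equivI[OF R(1)])
    show "refl_on A R" by (rule refl_onI) (simp add: R(2) S_refl f)
    show "sym R" by (rule symI) (meson R(2) R_dest S_sym)
    show "trans R" by (rule transI) (meson R(2) R_dest S_trans)
  qed
  show resp: "(\<lambda>a. S `` {f a}) respects R"
  proof (rule congruentI)
    fix a b assume ab: "(a, b) \<in> R"
    then have "(f a, f b) \<in> S" by (rule R_dest)
    then show "S `` {f a} = S `` {f b}" by (rule equiv_class_eq[OF S])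
  qed
  have val: "(\<Union>b\<in>R `` {a}. S `` {f b}) = S `` {f a}" if "a \<in> A" for a
    by (rule UN_equiv_class[OF E resp that])
  show "bij_betw (\<lambda>C. \<Union>a\<in>C. S `` {f a}) (A // R) (B // S)"
  proof (rule bij_betw_imageI)
    show "inj_on (\<lambda>C. \<Union>a\<in>C. S `` {f a}) (A // R)"
    proof (rule inj_onI)
      fix C D assume "C \<in> A // R" "D \<in> A // R"
        and eq: "(\<Union>a\<in>C. S `` {f a}) = (\<Union>a\<in>D. S `` {f a})"
      then obtain a b where ab: "a \<in> A" "C = R `` {a}" "b \<in> A" "D = R `` {b}" by (auto elim!: quotientE)
      then have "S `` {f a} = S `` {f b}" using eq val by simp
      then have "(f a, f b) \<in> S" using eq_equiv_class[OF _ S] f ab by blast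
      then have "(a, b) \<in> R" using R ab by blast
      then show "C = D" using ab equiv_class_eq[OF E] by blast
    qed
    show "(\<lambda>C. \<Union>a\<in>C. S `` {f a}) ` (A // R) = B // S"
    proof (intro equalityI subsetI)
      fix Y assume "Y \<in> (\<lambda>C. \<Union>a\<in>C. S `` {f a}) ` (A // R)"
      then obtain a where "a \<in> A" "Y = S `` {f a}" using val by (auto elim!: quotientE)
      then show "Y \<in> B // S" using f by (auto intro: quotientI)
    next
      fix Y assume "Y \<in> B // S"
      then obtain b where b: "b \<in> B" "Y = S `` {b}" by (auto elim!: quotientE)
      then obtain a where a: "a \<in> A" "(f a, b) \<in> S" using surj by blast
      then have "Y = S `` {f a}" using b equiv_class_eq[OF S] by blast
      then have "Y = (\<Union>b\<in>R `` {a}. S `` {f b})" using val a by simp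
      moreover have "R `` {a} \<in> A // R" using a by (intro quotientI)
      ultimately show "Y \<in> (\<lambda>C. \<Union>a\<in>C. S `` {f a}) ` (A // R)" by blast
    qed
  qed
qed

theorem PH2_bij_Ext:
  fixes P :: "('k, 'p) poisson" and V :: "('k, 'v) poisson"
  assumes "poisson_algebra K P" and "poisson_algebra K V"
  shows "equiv (LPS K P V) (local_cohom K P V)"
    and "(\<lambda>c. ext_equiv K P V `` {crossed_product_ext P V c} :: ('k, 'p, 'v, 'p \<times> 'v) ext_data set)
      respects (local_cohom K P V)"
    and "bij_betw (\<lambda>C. \<Union>c\<in>C. ext_equiv K P V `` {crossed_product_ext P V c}) (PH2 K P V) (Ext K P V)"
proof -
  have sub: "local_cohom K P V \<subseteq> LPS K P V \<times> LPS K P V" by (auto simp: local_cohom_def)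
  note * = bij_betw_quotients[where A = "LPS K P V" and f = "crossed_product_ext P V",
      OF equiv_ext_equiv crossed_product_ext_in_extensions sub local_cohom_iff_ext_equiv
      extension_equiv_crossed_product[OF assms(2,1)], simplified]
  show "equiv (LPS K P V) (local_cohom K P V)"
    "(\<lambda>c. ext_equiv K P V `` {crossed_product_ext P V c} :: ('k, 'p, 'v, 'p \<times> 'v) ext_data set)
      respects (local_cohom K P V)"
    "bij_betw (\<lambda>C. \<Union>c\<in>C. ext_equiv K P V `` {crossed_product_ext P V c}) (PH2 K P V) (Ext K P V)"
    unfolding PH2_def Ext_def by (fact *)+
qed

section \<open>Letting the structure on the kernel vary\<close>

lemma assemble_eq_iff [simp]: "assemble s c = assemble s' c' \<longleftrightarrow> s = s' \<and> c = c'"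
  by (cases s; cases s'; cases c; cases c') (auto simp: assemble_def)

lemma assemble_surj: "\<exists>s c. d = assemble s c"
proof -
  obtain la ra \<theta> m tr f b where "d = (la, ra, \<theta>, m, tr, f, b)" by (cases d) auto
  then have "d = assemble (m, b) (la, ra, \<theta>, tr, f)" by (simp add: assemble_def)
  then show ?thesis by blast
qed

lemma assemble_in_crossed_systems:
  "assemble s c \<in> crossed_systems K P V \<longleftrightarrow>
     s \<in> poisson_structures K V \<and> c \<in> LPS K P (case_prod (with_poisson V) s)"
  by (cases s; cases c) (simp add: assemble_def crossed_systems_def)

lemma assemble_cohom:
  "(assemble s c, assemble s' c') \<in> cohom K P V \<longleftrightarrow>
     s = s' \<and> s \<in> poisson_structures K V \<and> (c, c') \<in> local_cohom K P (case_prod (with_poisson V) s)"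
proof -
  have "(c, c') \<in> local_cohom K P (case_prod (with_poisson V) s) \<Longrightarrow>
      c \<in> LPS K P (case_prod (with_poisson V) s) \<and> c' \<in> LPS K P (case_prod (with_poisson V) s)"
    by (auto simp: local_cohom_def)
  then show ?thesis
    by (cases s; cases s'; cases c; cases c')
      (auto simp: assemble_def cohom_def crossed_systems_def)
qed

text \<open>
  The relation on 7-tuples keeps the structure on \<open>V\<close> fixed, so its classes are copies of the local
  classes.  This is the whole content of the disjoint union decomposition.
\<close>

lemma cohom_class_assemble:
  assumes "s \<in> poisson_structures K V"
  shows "cohom K P V `` {assemble s c} = assemble s ` (local_cohom K P (case_prod (with_poisson V) s) `` {c})"
proof (intro equalityI subsetI)
  fix d assume d: "d \<in> cohom K P V `` {assemble s c}"
  obtain s' c' where "d = assemble s' c'" using assemble_surj by blast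
  then show "d \<in> assemble s ` (local_cohom K P (case_prod (with_poisson V) s) `` {c})"
    using d by (auto simp: assemble_cohom)
qed (use assms in \<open>auto simp: assemble_cohom\<close>)

lemma GPH2_bij_PH2:
  assumes P: "poisson_algebra K P"
  shows "s \<in> poisson_structures K V \<Longrightarrow>
      (\<lambda>c. cohom K P V `` {assemble s c}) respects (local_cohom K P (case_prod (with_poisson V) s))"
    and "bij_betw (\<lambda>(s, C). \<Union>c\<in>C. cohom K P V `` {assemble s c})
          (SIGMA s : poisson_structures K V. PH2 K P (case_prod (with_poisson V) s)) (GPH2 K P V)"
proof -
  let ?W = "case_prod (with_poisson V)"
  have E: "equiv (LPS K P (?W s)) (local_cohom K P (?W s))" if "s \<in> poisson_structures K V" for s
    using that by (intro PH2_bij_Ext(1)[OF P]) (auto simp: poisson_structures_def)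
  show resp: "(\<lambda>c. cohom K P V `` {assemble s c}) respects (local_cohom K P (?W s))"
    if s: "s \<in> poisson_structures K V" for s
  proof (rule congruentI)
    fix c c' assume "(c, c') \<in> local_cohom K P (?W s)"
    then show "cohom K P V `` {assemble s c} = cohom K P V `` {assemble s c'}"
      using equiv_class_eq[OF E[OF s]] by (simp add: cohom_class_assemble[OF s])
  qed
  let ?F = "\<lambda>s C. \<Union>c\<in>C. cohom K P V `` {assemble s c}"
  have F: "?F s (local_cohom K P (?W s) `` {c}) = cohom K P V `` {assemble s c}"
    if "s \<in> poisson_structures K V" "c \<in> LPS K P (?W s)" for s c
    by (rule UN_equiv_class[OF E[OF that(1)] resp[OF that(1)] that(2)])
  have image: "?F s C = assemble s ` C" and ne: "C \<noteq> {}"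
    if s: "s \<in> poisson_structures K V" and C: "C \<in> PH2 K P (?W s)" for s C
  proof -
    obtain c where c: "c \<in> LPS K P (?W s)" "C = local_cohom K P (?W s) `` {c}"
      using C unfolding PH2_def by (rule quotientE)
    then show "?F s C = assemble s ` C" using F[OF s c(1)] by (simp add: cohom_class_assemble[OF s])
    show "C \<noteq> {}" using c equiv_class_self[OF E[OF s]] by blast
  qed
  show "bij_betw (\<lambda>(s, C). ?F s C) (SIGMA s : poisson_structures K V. PH2 K P (?W s)) (GPH2 K P V)"
  proof (rule bij_betw_imageI)
    show "inj_on (\<lambda>(s, C). ?F s C) (SIGMA s : poisson_structures K V. PH2 K P (?W s))"
    proof (rule inj_onI)
      fix X Y
      assume "X \<in> (SIGMA s : poisson_structures K V. PH2 K P (?W s))"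
        "Y \<in> (SIGMA s : poisson_structures K V. PH2 K P (?W s))"
        and XY: "(\<lambda>(s, C). ?F s C) X = (\<lambda>(s, C). ?F s C) Y"
      then obtain s C s' C' where X: "X = (s, C)" "Y = (s', C')"
        and a: "s \<in> poisson_structures K V" "C \<in> PH2 K P (?W s)"
        "s' \<in> poisson_structures K V" "C' \<in> PH2 K P (?W s')"
        by (elim SigmaE) blast
      have "?F s C = ?F s' C'" using XY by (simp only: X prod.case)
      then have eq: "assemble s ` C = assemble s' ` C'" by (simp only: image a)
      obtain c where "c \<in> C" using ne a by blast
      then have "assemble s c \<in> assemble s' ` C'" using eq by blast
      then have "s = s'" by auto
      moreover have "inj (assemble s)" by (simp add: inj_def)
      ultimately show "X = Y" using eq unfolding X by (metis inj_image_eq_iff)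
    qed
    show "(\<lambda>(s, C). ?F s C) ` (SIGMA s : poisson_structures K V. PH2 K P (?W s)) = GPH2 K P V"
    proof (intro equalityI subsetI)
      fix D assume "D \<in> (\<lambda>(s, C). ?F s C) ` (SIGMA s : poisson_structures K V. PH2 K P (?W s))"
      then obtain s C where s: "s \<in> poisson_structures K V" "C \<in> PH2 K P (?W s)" "D = ?F s C"
        by (elim imageE SigmaE) (simp only: prod.case)
      obtain c where c: "c \<in> LPS K P (?W s)" "C = local_cohom K P (?W s) `` {c}"
        using s(2) unfolding PH2_def by (rule quotientE)
      then have "D = cohom K P V `` {assemble s c}" using F s by simp
      then show "D \<in> GPH2 K P V"
        using s c by (simp add: GPH2_def quotientI assemble_in_crossed_systems)
    next
      fix D assume "D \<in> GPH2 K P V"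
      then obtain d where d: "d \<in> crossed_systems K P V" "D = cohom K P V `` {d}"
        unfolding GPH2_def by (rule quotientE)
      obtain s c where sc: "d = assemble s c" using assemble_surj by blast
      then have s: "s \<in> poisson_structures K V" "c \<in> LPS K P (?W s)"
        using d by (simp_all add: assemble_in_crossed_systems)
      have "D = ?F s (local_cohom K P (?W s) `` {c})" using F s d sc by simp
      moreover have "local_cohom K P (?W s) `` {c} \<in> PH2 K P (?W s)"
        using s by (simp add: PH2_def quotientI)
      ultimately show "D \<in> (\<lambda>(s, C). ?F s C) ` (SIGMA s : poisson_structures K V. PH2 K P (?W s))"
        using s(1) by (intro image_eqI[where x = "(s, local_cohom K P (?W s) `` {c})"]) simp_all
    qed
  qed
qed

theorem corollary2p10:
  fixes K :: "('k, 'm) ring_scheme" and P :: "('k, 'p) poisson"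
  assumes "field K" and "poisson_algebra K P"
  shows
    "(\<forall>V :: ('k, 'v) poisson. poisson_algebra K V \<longrightarrow>
        equiv (LPS K P V) (local_cohom K P V) \<and>
        (\<lambda>c. ext_equiv K P V `` {crossed_product_ext P V c} :: ('k, 'p, 'v, 'p \<times> 'v) ext_data set)
          respects (local_cohom K P V) \<and>
        bij_betw (\<lambda>C. \<Union>c\<in>C. ext_equiv K P V `` {crossed_product_ext P V c})
          (PH2 K P V) (Ext K P V) \<and>
        (\<forall>X \<in> (extensions K P V :: ('k, 'p, 'v, 'u) ext_data set).
           \<exists>Y :: ('k, 'p, 'v, 'p \<times> 'v) ext_data. (X, Y) \<in> ext_equiv K P V))
     \<and>
     (\<forall>(E :: ('k, 'e) module) (\<pi> :: 'e \<Rightarrow> 'p) V.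
        module K E \<and> \<pi> \<in> lin_hom K E P \<and> \<pi> ` carrier E = carrier P \<and>
        V = E\<lparr>carrier := a_kernel E P \<pi>\<rparr> \<longrightarrow>
        (\<forall>s \<in> poisson_structures K V.
           (\<lambda>c. cohom K P V `` {assemble s c})
             respects (local_cohom K P (case_prod (with_poisson V) s))) \<and>
        bij_betw (\<lambda>(s, C). \<Union>c\<in>C. cohom K P V `` {assemble s c})
          (SIGMA s : poisson_structures K V. PH2 K P (case_prod (with_poisson V) s))
          (GPH2 K P V))"
proof (intro conjI allI impI ballI)
  fix V :: "('k, 'v) poisson"
  assume V: "poisson_algebra K V"
  note thms = PH2_bij_Ext[OF assms(2) V]
  show "equiv (LPS K P V) (local_cohom K P V)"
    and "(\<lambda>c. ext_equiv K P V `` {crossed_product_ext P V c} :: ('k, 'p, 'v, 'p \<times> 'v) ext_data set)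
          respects (local_cohom K P V)"
    and "bij_betw (\<lambda>C. \<Union>c\<in>C. ext_equiv K P V `` {crossed_product_ext P V c})
          (PH2 K P V) (Ext K P V)"
    by (rule thms)+
  fix X :: "('k, 'p, 'v, 'u) ext_data"
  assume "X \<in> extensions K P V"
  then show "\<exists>Y :: ('k, 'p, 'v, 'p \<times> 'v) ext_data. (X, Y) \<in> ext_equiv K P V"
    using extension_equiv_crossed_product[OF V assms(2)] ext_equiv_sym by blast
next
  fix E :: "('k, 'e) module" and V and s :: "('e \<Rightarrow> 'e \<Rightarrow> 'e) \<times> ('e \<Rightarrow> 'e \<Rightarrow> 'e)"
  assume "s \<in> poisson_structures K V"
  then show "(\<lambda>c. cohom K P V `` {assemble s c})
      respects (local_cohom K P (case_prod (with_poisson V) s))"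
    by (rule GPH2_bij_PH2(1)[OF assms(2)])
qed (rule GPH2_bij_PH2(2)[OF assms(2)])

end
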